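(* Let $G=(V,E)$ be a graph that is finite, or countably infinite with bounded degree. Let $W$ be a finite subset of $V$. Then for $0\le t\le1$, for dimer RSA, $$P[X_t^V(v)=0,\ v\in W]=P[X_t^{\widetilde V_W}(v)=0,\ v\in W^*],$$ and for the annihilation process, $$P[X_t^V(v)=1,\ v\in W]=P[X_t^{\widetilde V_W}(v)=1,\ v\in W^*].$$ Here $\widetilde G_W=(\widetilde V_W,\widetilde E_W)$ is the graph obtained from $G$ by splitting the vertices in $W$, and $W^*\subseteq\widetilde V_W$ is the set of degree-one vertices replacing those of $W$, as defined in the context.
   Context: Graphs have no loops or multiple edges. $P[X(v)=i,\ v\in A]$ is the probability that $X(v)=i$ for every $v\in A$. Splitting: for a vertex $w$ of $G$ with neighbours $n_1(w),\dots,n_{d(w)}(w)$, $d(w)$ being the degree of $w$, let $\widetilde G_{\{w\}}=(\widetilde V_{\{w\}},\widetilde E_{\{w\}})$ be the graph obtained from $G$ by replacing $w$ with $d(w)$ vertices $v_1^*,\dots,v_{d(w)}^*$ of degree $1$, where $v_i^*$ is joined by an edge to $n_i(w)$ (and to nothing else). For finite $W\subseteq V$, $\widetilde G_W=(\widetilde V_W,\widetilde E_W)$ is the graph obtained from $G$ by successively performing this replacement for each $w\in W$, i.e. inductively $\widetilde G_{W\cup\{w\}}=\widetilde{(\widetilde G_W)}_{\{w\}}$ for $w\in V\setminus W$ (the order is immaterial). $W^*$ is the set of vertices of $\widetilde G_W$ that replace the original vertices in $W$, a total of $\sum_{w\in W}d(w)$ vertices. Processes on a finite graph $V$ with edge set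 $E$; states are $1$ (occupied) and $0$ (vacant), and $X_t^V(v)$ is the state of $v$ at time $t$. The $\tau_e$, $e\in E$, are i.i.d. uniform on $(0,1)$. Dimer RSA: all sites are initially vacant; at time $\tau_e$, $e=\{u,v\}$, if $u$ and $v$ are both vacant then both become occupied; otherwise nothing changes. Occupied sites stay occupied forever. Annihilation process: all sites are initially occupied; at time $\tau_e$, $e=\{u,v\}$, if $u$ and $v$ are both occupied immediately before, then one of them, each with probability $1/2$ (chosen independently of everything else), becomes vacant; otherwise nothing changes. Vacant sites stay vacant forever. For countably infinite graphs $V$ of bounded degree, $X_t^V(v):=\lim_n X_t^{V_n}(v)$, where $(V_n)$ is any sequence of finite subsets of $V$ with $\bigcup_n\bigcap_{m\ge n}V_m=V$ and the process on the induced subgraph $V_n$ uses the same $\tau_e$ and attack directions; almost surely this limit exists for all $v,t$ and does not depend on the sequence. *)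

theory Defs
  imports "HOL-Probability.Probability"
begin

section \<open>Simple graphs\<close>

type_synonym 'v graph = "'v set \<times> 'v set set"

abbreviation verts :: "'v graph \<Rightarrow> 'v set" where "verts G \<equiv> fst G"
abbreviation edges :: "'v graph \<Rightarrow> 'v set set" where "edges G \<equiv> snd G"

definition simple_graph :: "'v graph \<Rightarrow> bool" where
  "simple_graph G \<longleftrightarrow> (\<forall>e\<in>edges G. e \<subseteq> verts G \<and> card e = 2)"

definition neighbours :: "'v graph \<Rightarrow> 'v \<Rightarrow> 'v set" where
  "neighbours G v = {u. {v, u} \<in> edges G}"

definition degree :: "'v graph \<Rightarrow> 'v \<Rightarrow> nat" where
  "degree G v = card (neighbours G v)"

definition bounded_degree :: "'v graph \<Rightarrow> bool" where
  "bounded_degree G \<longleftrightarrow> (\<exists>D. \<forall>v\<in>verts G. finite (neighbours G v) \<and> degree G v \<le> D)"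

definition induced_subgraph :: "'v graph \<Rightarrow> 'v set \<Rightarrow> 'v graph" where
  "induced_subgraph G U = (U, {e \<in> edges G. e \<subseteq> U})"


section \<open>Splitting vertices\<close>

text \<open>
  Vertices of a split graph: \<open>Orig v\<close> is an unsplit vertex \<open>v\<close>, and \<open>Copy w n\<close> is the vertex
  replacing \<open>w\<close> at its end of the edge that joined \<open>w\<close> and \<open>n\<close> in the original graph.
\<close>

datatype 'v split_vert = Orig 'v | Copy 'v 'v

primrec origin :: "'v split_vert \<Rightarrow> 'v" where
  "origin (Orig v) = v"
| "origin (Copy w n) = w"

text \<open>
  A neighbour \<open>x\<close> of \<open>w\<close> may itself already be the copy of a split vertex; the vertex of degree 1
  attached to it is always named \<open>Copy w (origin x)\<close>. Different neighbours of \<open>w\<close> have different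
  origins (\<open>inj_on_origin_neighbours\<close> below), so there is one copy of \<open>w\<close> for each neighbour, and
  the naming makes the outcome of successive splittings literally independent of their order.
\<close>

definition split_vertex :: "'v \<Rightarrow> 'v split_vert graph \<Rightarrow> 'v split_vert graph" where
  "split_vertex w H =
    (verts H - {Orig w} \<union> {Copy w (origin x) | x. x \<in> neighbours H (Orig w)},
     {e \<in> edges H. Orig w \<notin> e} \<union> {{Copy w (origin x), x} | x. x \<in> neighbours H (Orig w)})"

definition split_graph :: "'v graph \<Rightarrow> 'v set \<Rightarrow> 'v split_vert graph" where
  "split_graph G W =
    Finite_Set.fold split_vertex (Orig ` verts G, (\<lambda>e. Orig ` e) ` edges G) W"

definition copies :: "'v graph \<Rightarrow> 'v set \<Rightarrow> 'v split_vert set" where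
  "copies G W = {x \<in> verts (split_graph G W). \<exists>w\<in>W. \<exists>n. x = Copy w n}"

lemma edges_split_vertex_iff:
  "e \<in> edges (split_vertex w H) \<longleftrightarrow>
    (e \<in> edges H \<and> Orig w \<notin> e) \<or> (\<exists>x. e = {Copy w (origin x), x} \<and> {Orig w, x} \<in> edges H)"
  by (auto simp: split_vertex_def neighbours_def)

lemma verts_split_vertex_iff:
  "y \<in> verts (split_vertex w H) \<longleftrightarrow>
    (y \<in> verts H \<and> y \<noteq> Orig w) \<or> (\<exists>x. y = Copy w (origin x) \<and> {Orig w, x} \<in> edges H)"
  by (auto simp: split_vertex_def neighbours_def)

lemma nbr_split_vertex_iff:
  assumes "u \<noteq> w"
  shows "{Orig u, x} \<in> edges (split_vertex w H) \<longleftrightarrow>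
    (x \<noteq> Orig w \<and> {Orig u, x} \<in> edges H) \<or> (x = Copy w u \<and> {Orig u, Orig w} \<in> edges H)"
  using assms by (auto simp: edges_split_vertex_iff doubleton_eq_iff insert_commute)

lemma split_vertex_commute_aux_verts:
  assumes "u \<noteq> w"
  shows "verts (split_vertex u (split_vertex w H)) \<subseteq> verts (split_vertex w (split_vertex u H))"
proof
  fix y assume "y \<in> verts (split_vertex u (split_vertex w H))"
  then consider "y \<in> verts (split_vertex w H)" "y \<noteq> Orig u"
    | x where "y = Copy u (origin x)" "{Orig u, x} \<in> edges (split_vertex w H)"
    by (auto simp: verts_split_vertex_iff[of _ u])
  then show "y \<in> verts (split_vertex w (split_vertex u H))"
  proof cases
    case 1
    then consider "y \<in> verts H" "y \<noteq> Orig w"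
      | x where "y = Copy w (origin x)" "{Orig w, x} \<in> edges H"
      by (auto simp: verts_split_vertex_iff)
    then show ?thesis
    proof cases
      case a: 1
      then show ?thesis using 1 by (simp add: verts_split_vertex_iff)
    next
      case (2 x)
      have "\<exists>x'. origin x' = origin x \<and> {Orig w, x'} \<in> edges (split_vertex u H)"
      proof (cases "x = Orig u")
        case True
        then show ?thesis using 2 assms
          by (intro exI[of _ "Copy u w"]) (simp add: nbr_split_vertex_iff)
      next
        case False
        then show ?thesis using 2 assms
          by (intro exI[of _ x]) (simp add: nbr_split_vertex_iff)
      qed
      then show ?thesis
        using 2 by (subst verts_split_vertex_iff) metis
    qed
  next
    case (2 x)
    then show ?thesis using assms
      by (auto simp: nbr_split_vertex_iff verts_split_vertex_iff)
  qed
qed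

lemma split_vertex_commute_aux_edges:
  assumes "u \<noteq> w"
  shows "edges (split_vertex u (split_vertex w H)) \<subseteq> edges (split_vertex w (split_vertex u H))"
proof
  fix e assume "e \<in> edges (split_vertex u (split_vertex w H))"
  then consider "e \<in> edges (split_vertex w H)" "Orig u \<notin> e"
    | x where "e = {Copy u (origin x), x}" "{Orig u, x} \<in> edges (split_vertex w H)"
    by (auto simp: edges_split_vertex_iff[of _ u])
  then show "e \<in> edges (split_vertex w (split_vertex u H))"
  proof cases
    case 1
    then consider "e \<in> edges H" "Orig w \<notin> e"
      | x where "e = {Copy w (origin x), x}" "{Orig w, x} \<in> edges H" "x \<noteq> Orig u"
      by (auto simp: edges_split_vertex_iff)
    then show ?thesis
    proof cases
      case a: 1
      then show ?thesis using 1 by (simp add: edges_split_vertex_iff)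
    next
      case (2 x)
      then have "{Orig w, x} \<in> edges (split_vertex u H)"
        using assms by (simp add: nbr_split_vertex_iff)
      then show ?thesis using 2 by (subst edges_split_vertex_iff) blast
    qed
  next
    case (2 x)
    then consider "x \<noteq> Orig w" "{Orig u, x} \<in> edges H"
      | "x = Copy w u" "{Orig u, Orig w} \<in> edges H"
      using assms by (auto simp: nbr_split_vertex_iff)
    then show ?thesis
    proof cases
      case a: 1
      then have "e \<in> edges (split_vertex u H)" "Orig w \<notin> e"
        using 2 by (auto simp: edges_split_vertex_iff)
      then show ?thesis by (simp add: edges_split_vertex_iff)
    next
      case b: 2
      have "{Orig w, Copy u w} \<in> edges (split_vertex u H)"
        using b assms by (simp add: nbr_split_vertex_iff insert_commute)
      moreover have "e = {Copy w (origin (Copy u w)), Copy u w}"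
        using 2 b by (simp add: insert_commute)
      ultimately show ?thesis by (subst edges_split_vertex_iff) blast
    qed
  qed
qed

lemma split_vertex_commute:
  "split_vertex u (split_vertex w H) = split_vertex w (split_vertex u H)"
proof (cases "u = w")
  case False
  then show ?thesis
    using split_vertex_commute_aux_verts[of u w H] split_vertex_commute_aux_verts[of w u H]
      split_vertex_commute_aux_edges[of u w H] split_vertex_commute_aux_edges[of w u H]
    by (intro prod_eqI) auto
qed simp

interpretation split_vertex: comp_fun_commute split_vertex
  by unfold_locales (simp add: fun_eq_iff split_vertex_commute)

lemma split_graph_empty:
  "split_graph G {} = (Orig ` verts G, (\<lambda>e. Orig ` e) ` edges G)"
  by (simp add: split_graph_def)

lemma split_graph_insert:
  assumes "finite W" "w \<notin> W"
  shows "split_graph G (insert w W) = split_vertex w (split_graph G W)"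
  using assms by (simp add: split_graph_def)

lemma neighbours_split_graph:
  assumes "finite W" "w \<notin> W"
  shows "neighbours (split_graph G W) (Orig w) =
    (\<lambda>n. if n \<in> W then Copy n w else Orig n) ` neighbours G w"
  using assms
proof (induction W)
  case empty
  show ?case
  proof (intro set_eqI iffI)
    fix x assume "x \<in> neighbours (split_graph G {}) (Orig w)"
    then obtain e where e: "e \<in> edges G" "Orig ` e = {Orig w, x}"
      by (auto simp: neighbours_def split_graph_empty)
    then have "x \<in> Orig ` e" by simp
    then obtain n where n: "x = Orig n" by blast
    with e have "Orig ` e = Orig ` {w, n}" by simp
    then have "e = {w, n}"
      by (subst (asm) inj_image_eq_iff) (simp_all add: inj_def)
    with e n show "x \<in> (\<lambda>n. if n \<in> {} then Copy n w else Orig n) ` neighbours G w"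
      by (auto simp: neighbours_def)
  next
    fix x assume "x \<in> (\<lambda>n. if n \<in> {} then Copy n w else Orig n) ` neighbours G w"
    then obtain n where "x = Orig n" "{w, n} \<in> edges G"
      by (auto simp: neighbours_def)
    then have "{Orig w, x} = Orig ` {w, n}" by simp
    with \<open>{w, n} \<in> edges G\<close> show "x \<in> neighbours (split_graph G {}) (Orig w)"
      unfolding neighbours_def split_graph_empty snd_conv by blast
  qed
next
  case (insert a W)
  have "neighbours (split_graph G (insert a W)) (Orig w) =
      {x \<in> neighbours (split_graph G W) (Orig w). x \<noteq> Orig a} \<union>
      (if Orig a \<in> neighbours (split_graph G W) (Orig w) then {Copy a w} else {})"
    using insert by (auto simp: split_graph_insert neighbours_def nbr_split_vertex_iff)
  then show ?case
    using insert by (auto split: if_splits)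
qed

lemma inj_on_origin_neighbours:
  assumes "finite W" "w \<notin> W"
  shows "inj_on origin (neighbours (split_graph G W) (Orig w))"
  unfolding neighbours_split_graph[OF assms] by (auto simp: inj_on_def split: if_splits)

lemma verts_split_graph:
  assumes "finite W"
  shows "verts (split_graph G W) =
    Orig ` (verts G - W) \<union> {Copy w n | w n. w \<in> W \<and> n \<in> neighbours G w}"
  using assms
proof (induction W)
  case empty
  then show ?case by (simp add: split_graph_empty)
next
  case (insert a W)
  have "{Copy a (origin x) | x. x \<in> neighbours (split_graph G W) (Orig a)}
      = (\<lambda>x. Copy a (origin x)) ` neighbours (split_graph G W) (Orig a)"
    by blast
  also have "\<dots> = Copy a ` neighbours G a"
    unfolding neighbours_split_graph[OF insert(1,2)] image_image by (intro image_cong) auto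
  also have "\<dots> = {Copy a n | n. n \<in> neighbours G a}"
    by blast
  finally have "{Copy a (origin x) | x. x \<in> neighbours (split_graph G W) (Orig a)}
      = {Copy a n | n. n \<in> neighbours G a}" .
  then have "verts (split_graph G (insert a W)) =
      verts (split_graph G W) - {Orig a} \<union> {Copy a n | n. n \<in> neighbours G a}"
    using insert by (simp add: split_graph_insert split_vertex_def)
  then show ?case
    using insert by auto
qed

lemma copies_eq:
  assumes "finite W"
  shows "copies G W = {Copy w n | w n. w \<in> W \<and> n \<in> neighbours G w}"
  using assms by (auto simp: copies_def verts_split_graph)

lemma card_copies:
  assumes "finite W" "\<And>w. w \<in> W \<Longrightarrow> finite (neighbours G w)"
  shows "card (copies G W) = (\<Sum>w\<in>W. degree G w)"
proof -
  have "copies G W = (\<lambda>(w, n). Copy w n) ` (SIGMA w:W. neighbours G w)"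
    using assms by (auto simp: copies_eq image_iff)
  moreover have "inj_on (\<lambda>(w, n). Copy w n) (SIGMA w:W. neighbours G w)"
    by (auto simp: inj_on_def)
  ultimately show ?thesis
    using assms by (simp add: card_image degree_def)
qed


section \<open>Dynamics on finite graphs\<close>

text \<open>
  An edge \<open>e\<close> rings at time \<open>\<tau> e\<close>. The ringing edges are processed in increasing order of time; this
  order is unique unless two of the times coincide, which has probability 0.
\<close>

definition rings_until :: "'v graph \<Rightarrow> ('v set \<Rightarrow> real) \<Rightarrow> real \<Rightarrow> 'v set list" where
  "rings_until G \<tau> t =
    (SOME es. set es = {e \<in> edges G. \<tau> e \<le> t} \<and> distinct es \<and> sorted (map \<tau> es))"

definition dimer_step :: "'v set \<Rightarrow> ('v \<Rightarrow> nat) \<Rightarrow> 'v \<Rightarrow> nat" where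
  "dimer_step e x = (if \<forall>u\<in>e. x u = 0 then (\<lambda>v. if v \<in> e then 1 else x v) else x)"

definition dimer_finite :: "'v graph \<Rightarrow> ('v set \<Rightarrow> real) \<Rightarrow> real \<Rightarrow> 'v \<Rightarrow> nat" where
  "dimer_finite G \<tau> t = fold dimer_step (rings_until G \<tau> t) (\<lambda>_. 0)"

text \<open>\<open>d e\<close> is the endpoint of \<open>e\<close> that is attacked when \<open>e\<close> rings.\<close>

definition annihilation_step :: "('v set \<Rightarrow> 'v) \<Rightarrow> 'v set \<Rightarrow> ('v \<Rightarrow> nat) \<Rightarrow> 'v \<Rightarrow> nat" where
  "annihilation_step d e x = (if \<forall>u\<in>e. x u = 1 then x(d e := 0) else x)"

definition annihilation_finite ::
    "'v graph \<Rightarrow> ('v set \<Rightarrow> real) \<Rightarrow> ('v set \<Rightarrow> 'v) \<Rightarrow> real \<Rightarrow> 'v \<Rightarrow> nat" where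
  "annihilation_finite G \<tau> d t = fold (annihilation_step d) (rings_until G \<tau> t) (\<lambda>_. 1)"


section \<open>Infinite graphs\<close>

definition exhausts :: "(nat \<Rightarrow> 'v set) \<Rightarrow> 'v set \<Rightarrow> bool" where
  "exhausts U V \<longleftrightarrow> (\<forall>n. finite (U n) \<and> U n \<subseteq> V) \<and> (\<Union>n. \<Inter>m\<in>{n..}. U m) = V"

text \<open>
  The common limit of \<open>f (U n)\<close> over all exhausting sequences \<open>U\<close> (an unspecified constant if there
  is none, which for the processes below has probability 0).
\<close>

definition exhaustion_lim :: "'v set \<Rightarrow> ('v set \<Rightarrow> nat) \<Rightarrow> nat" where
  "exhaustion_lim V f = (THE x. \<forall>U. exhausts U V \<longrightarrow> (\<lambda>n. f (U n)) \<longlonglongrightarrow> x)"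

definition dimer :: "'v graph \<Rightarrow> ('v set \<Rightarrow> real) \<Rightarrow> real \<Rightarrow> 'v \<Rightarrow> nat" where
  "dimer G \<tau> t v =
    (if finite (verts G) then dimer_finite G \<tau> t v
     else exhaustion_lim (verts G) (\<lambda>U. dimer_finite (induced_subgraph G U) \<tau> t v))"

definition annihilation ::
    "'v graph \<Rightarrow> ('v set \<Rightarrow> real) \<Rightarrow> ('v set \<Rightarrow> 'v) \<Rightarrow> real \<Rightarrow> 'v \<Rightarrow> nat" where
  "annihilation G \<tau> d t v =
    (if finite (verts G) then annihilation_finite G \<tau> d t v
     else exhaustion_lim (verts G) (\<lambda>U. annihilation_finite (induced_subgraph G U) \<tau> d t v))"


section \<open>The probability spaces\<close>

definition ring_times :: "'v graph \<Rightarrow> ('v set \<Rightarrow> real) measure" where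
  "ring_times G = (\<Pi>\<^sub>M e\<in>edges G. uniform_measure lborel {0<..<1})"

definition attacks :: "'v graph \<Rightarrow> ('v set \<Rightarrow> 'v) measure" where
  "attacks G = (\<Pi>\<^sub>M e\<in>edges G. measure_pmf (pmf_of_set e))"

end

theory Submission
  imports Defs "HOL-Combinatorics.Multiset_Permutations"
begin

text \<open>
  Sending each copy to the vertex that it replaces (\<open>origin\<close>) maps the edges of the split graph
  bijectively onto those of \<open>G\<close>. So the two graphs can be driven by the
  same ringing times and the same attacks, and under this coupling the two events coincide almost
  surely. To see this on a finite graph, call the initial state of a vertex (vacant for dimer RSA,
  occupied for annihilation) \<^emph>\<open>fresh\<close>. An edge acts only when both its ends are fresh, and vertices that
  have left the fresh state never return. As long as all vertices of \<open>W\<close> are fresh, so are all their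
  copies, and the two processes agree everywhere; the first ring that makes a vertex of \<open>W\<close> leave the
  fresh state does the same to one of its copies, and conversely. This is
  \<open>fold_step_quotient\<close>; both processes are instances of one rule (\<open>flip_rule\<close>).

  On an infinite graph the process is a limit along finite vertex sets, and it has to be shown that the
  limit exists almost surely. The state of \<open>v\<close> can only depend on edges that are reached from \<open>v\<close> by a
  path of edges with decreasing ringing times (\<open>fold_step_influence\<close>). With at most \<open>D\<close> edges at each vertex
  there are at most \<open>(2 D)^k\<close> paths of \<open>k\<close> edges from \<open>v\<close>, and each is decreasing with probability at most
  \<open>1 / k!\<close>, because all orders of \<open>k\<close> independent identically distributed times are equally likely. Since
  \<open>(2 D)^k / k!\<close> tends to \<open>0\<close>, almost surely only finitely many edges matter
  (\<open>AE_run_stabilises\<close>), and then a large finite vertex set already shows the limits in both graphs,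
  to which the finite case applies (\<open>process_split_graph\<close>).

  Finally, the coupling carries one product measure to the other (\<open>distr_unsplit\<close>), and the events are
  measurable (\<open>sets_all_process_eq\<close>), so that almost sure equality of the events gives equality of
  their probabilities.
\<close>

section \<open>Product measures\<close>

text \<open>
  Relabelling the coordinates along an injection, and applying to each coordinate a map that carries
  its law to the desired one, yields the product measure again. The coupling of the two graphs is of
  this form.
\<close>

lemma distr_PiM_transport:
  assumes M: "\<And>k. k \<in> K \<Longrightarrow> prob_space (M k)"
    and N: "\<And>i. i \<in> I \<Longrightarrow> prob_space (N i)"
    and f: "inj_on f I" "f \<in> I \<rightarrow> K"
    and g: "\<And>i. i \<in> I \<Longrightarrow> g i \<in> measurable (M (f i)) (N i)"
    and gN: "\<And>i. i \<in> I \<Longrightarrow> distr (M (f i)) (N i) (g i) = N i"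
  shows "(\<lambda>\<omega>. \<lambda>i\<in>I. g i (\<omega> (f i))) \<in> measurable (Pi\<^sub>M K M) (Pi\<^sub>M I N)"
    and "distr (Pi\<^sub>M K M) (Pi\<^sub>M I N) (\<lambda>\<omega>. \<lambda>i\<in>I. g i (\<omega> (f i))) = Pi\<^sub>M I N"
proof -
  let ?t = "\<lambda>\<omega>. \<lambda>i\<in>I. g i (\<omega> (f i))"
  show t: "?t \<in> measurable (Pi\<^sub>M K M) (Pi\<^sub>M I N)"
  proof (rule measurable_restrict)
    fix i assume i: "i \<in> I"
    then have "(\<lambda>\<omega>. \<omega> (f i)) \<in> measurable (Pi\<^sub>M K M) (M (f i))"
      using f by (intro measurable_component_singleton) auto
    then show "(\<lambda>\<omega>. g i (\<omega> (f i))) \<in> measurable (Pi\<^sub>M K M) (N i)"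
      using g[OF i] by (rule measurable_compose)
  qed
  show "distr (Pi\<^sub>M K M) (Pi\<^sub>M I N) ?t = Pi\<^sub>M I N"
  proof (rule measure_eqI_PiM_infinite[symmetric, OF refl])
    interpret prob_space "Pi\<^sub>M I N" using N by (rule prob_space_PiM)
    show "finite_measure (Pi\<^sub>M I N)" by unfold_locales
    fix A J assume J: "finite J" "J \<subseteq> I" and A: "\<And>i. i \<in> J \<Longrightarrow> A i \<in> sets (N i)"
    \<comment> \<open>The preimage of the cylinder over the sets \<open>A i\<close> is the cylinder over the sets \<open>B k\<close>.\<close>
    define B where "B k = g (the_inv_into I f k) -` A (the_inv_into I f k) \<inter> space (M k)" for k
    have inv: "the_inv_into I f (f i) = i" if "i \<in> J" for i
      using that J f by (intro the_inv_into_f_f) auto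
    have B: "B (f i) = g i -` A i \<inter> space (M (f i))" if "i \<in> J" for i
      using inv[OF that] by (simp add: B_def)
    have Bs: "B k \<in> sets (M k)" if "k \<in> f ` J" for k
    proof -
      obtain i where i: "i \<in> J" "k = f i" using \<open>k \<in> f ` J\<close> by blast
      show ?thesis
        unfolding i(2) B[OF i(1)] using i J A g by (intro measurable_sets[of _ _ "N i"]) auto
    qed
    have "Pi\<^sub>M I N (prod_emb I N J (Pi\<^sub>E J A)) = (\<Prod>i\<in>J. N i (A i))"
      using J A by (intro emeasure_PiM_emb N) auto
    also have "\<dots> = (\<Prod>i\<in>J. M (f i) (B (f i)))"
    proof (rule prod.cong)
      fix i assume i: "i \<in> J"
      have "N i (A i) = distr (M (f i)) (N i) (g i) (A i)"
        using gN i J by auto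
      also have "\<dots> = M (f i) (B (f i))"
        using i J A g by (subst emeasure_distr) (auto simp: B)
      finally show "N i (A i) = M (f i) (B (f i))" .
    qed simp
    also have "\<dots> = (\<Prod>k\<in>f ` J. M k (B k))"
      using f J by (subst prod.reindex) (auto intro: inj_on_subset)
    also have "\<dots> = Pi\<^sub>M K M (prod_emb K M (f ` J) (Pi\<^sub>E (f ` J) B))"
      using f J Bs by (intro emeasure_PiM_emb[symmetric] M) auto
    also have "prod_emb K M (f ` J) (Pi\<^sub>E (f ` J) B) =
        ?t -` prod_emb I N J (Pi\<^sub>E J A) \<inter> space (Pi\<^sub>M K M)"
    proof (intro set_eqI iffI)
      fix \<omega> assume \<omega>: "\<omega> \<in> prod_emb K M (f ` J) (Pi\<^sub>E (f ` J) B)"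
      then have sp: "\<omega> \<in> space (Pi\<^sub>M K M)" and "\<And>i. i \<in> J \<Longrightarrow> \<omega> (f i) \<in> B (f i)"
        by (auto simp: prod_emb_def space_PiM PiE_iff)
      with J measurable_space[OF t sp]
      show "\<omega> \<in> ?t -` prod_emb I N J (Pi\<^sub>E J A) \<inter> space (Pi\<^sub>M K M)"
        by (auto simp: prod_emb_def space_PiM PiE_iff B)
    next
      fix \<omega> assume \<omega>: "\<omega> \<in> ?t -` prod_emb I N J (Pi\<^sub>E J A) \<inter> space (Pi\<^sub>M K M)"
      then have "g i (\<omega> (f i)) \<in> A i" "\<omega> (f i) \<in> space (M (f i))" if "i \<in> J" for i
        using that J f(2) by (auto simp: prod_emb_def space_PiM PiE_iff Pi_iff subset_iff)
      with \<omega> f(2) J show "\<omega> \<in> prod_emb K M (f ` J) (Pi\<^sub>E (f ` J) B)"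
        by (auto simp: prod_emb_def space_PiM PiE_iff B)
    qed
    also have "Pi\<^sub>M K M \<dots> = distr (Pi\<^sub>M K M) (Pi\<^sub>M I N) ?t (prod_emb I N J (Pi\<^sub>E J A))"
      using J A by (intro emeasure_distr[symmetric] t sets_PiM_I) auto
    finally show "Pi\<^sub>M I N (prod_emb I N J (Pi\<^sub>E J A)) =
        distr (Pi\<^sub>M K M) (Pi\<^sub>M I N) ?t (prod_emb I N J (Pi\<^sub>E J A))" .
  qed simp
qed

text \<open>
  By Fubini: once all coordinates except \<open>a\<close> are drawn, the coordinate \<open>a\<close> avoids the value at \<open>b\<close> because the
  law has no atoms.
\<close>

lemma AE_PiM_component_distinct:
  assumes M: "prob_space M" "sets M = sets borel" and atomless: "\<And>x. AE y in M. y \<noteq> x"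
    and ab: "a \<in> I" "b \<in> I" "a \<noteq> b"
  shows "AE \<omega> in Pi\<^sub>M I (\<lambda>_. M :: real measure). \<omega> a \<noteq> \<omega> b"
proof -
  let ?R = "Pi\<^sub>M (I - {a}) (\<lambda>_. M)"
  interpret M: prob_space M by fact
  interpret R: prob_space ?R using M by (intro prob_space_PiM)
  interpret P: pair_sigma_finite M ?R ..
  have [measurable_cong]: "sets M = sets borel" by fact
  have [measurable]: "(\<lambda>X. X b) \<in> measurable ?R M"
    using ab by (intro measurable_component_singleton) auto
  have "AE p in M \<Otimes>\<^sub>M ?R. fst p \<noteq> snd p b"
  proof (rule P.AE_pair_measure)
    have "b \<in> I - {a}" using ab by simp
    then have "fst \<in> borel_measurable (M \<Otimes>\<^sub>M ?R)" "(\<lambda>p. snd p b) \<in> borel_measurable (M \<Otimes>\<^sub>M ?R)"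
      by measurable
    then show "{p \<in> space (M \<Otimes>\<^sub>M ?R). fst p \<noteq> snd p b} \<in> sets (M \<Otimes>\<^sub>M ?R)"
      by (rule borel_measurable_neq)
    have "AE X in ?R. X b \<noteq> x" for x
      using ab M(1) atomless by (intro AE_PiM_component) auto
    then show "AE x in M. AE X in ?R. fst (x, X) \<noteq> snd (x, X) b"
      by (auto simp: eq_commute)
  qed
  then have "AE p in M \<Otimes>\<^sub>M ?R. (case p of (x, X) \<Rightarrow> X(a := x)) a \<noteq> (case p of (x, X) \<Rightarrow> X(a := x)) b"
    using ab(3) by (auto simp: case_prod_beta elim!: eventually_mono)
  then have "AE \<omega> in distr (M \<Otimes>\<^sub>M ?R) (Pi\<^sub>M (insert a (I - {a})) (\<lambda>_. M)) (\<lambda>(x, X). X(a := x)). \<omega> a \<noteq> \<omega> b"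
  proof (subst AE_distr_iff)
    show "(\<lambda>(x, X). X(a := x)) \<in> measurable (M \<Otimes>\<^sub>M ?R) (Pi\<^sub>M (insert a (I - {a})) (\<lambda>_. M))"
      by measurable
    have "(\<lambda>\<omega>. \<omega> i) \<in> borel_measurable (Pi\<^sub>M (insert a (I - {a})) (\<lambda>_. M))" if "i \<in> I" for i
    proof -
      have "i \<in> insert a (I - {a})" using that by simp
      then show ?thesis by measurable
    qed
    from borel_measurable_neq[OF this[OF ab(1)] this[OF ab(2)]]
    show "{\<omega> \<in> space (Pi\<^sub>M (insert a (I - {a})) (\<lambda>_. M)). \<omega> a \<noteq> \<omega> b} \<in> sets (Pi\<^sub>M (insert a (I - {a})) (\<lambda>_. M))" .
  qed
  moreover have I: "insert a (I - {a}) = I" using ab by auto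
  moreover have "distr (M \<Otimes>\<^sub>M ?R) (Pi\<^sub>M (insert a (I - {a})) (\<lambda>_. M)) (\<lambda>(x, X). X(a := x)) =
      Pi\<^sub>M (insert a (I - {a})) (\<lambda>_. M)"
    using M(1) by (intro distr_pair_PiM_eq_PiM)
  ultimately show ?thesis by (simp only: I)
qed

lemma AE_PiM_inj_on:
  assumes M: "prob_space M" "sets M = sets borel" and atomless: "\<And>x. AE y in M. y \<noteq> x"
    and I: "countable I"
  shows "AE \<omega> in Pi\<^sub>M I (\<lambda>_. M :: real measure). inj_on \<omega> I"
proof -
  have "AE \<omega> in Pi\<^sub>M I (\<lambda>_. M). a \<noteq> b \<longrightarrow> \<omega> a \<noteq> \<omega> b" if "a \<in> I" "b \<in> I" for a b
    using AE_PiM_component_distinct[OF assms(1-3) that] by (cases "a = b") auto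
  then have "AE \<omega> in Pi\<^sub>M I (\<lambda>_. M). \<forall>a\<in>I. \<forall>b\<in>I. a \<noteq> b \<longrightarrow> \<omega> a \<noteq> \<omega> b"
    using I by (simp add: AE_ball_countable)
  then show ?thesis
    by (auto simp: inj_on_def elim!: eventually_mono)
qed

definition decreasing :: "('i \<Rightarrow> real) \<Rightarrow> 'i list \<Rightarrow> bool" where
  "decreasing \<omega> = sorted_wrt (\<lambda>a b. \<omega> b < \<omega> a)"

lemma decreasing_distinct: "decreasing \<omega> xs \<Longrightarrow> distinct xs"
  unfolding decreasing_def by (induction "xs") auto

lemma decreasing_unique:
  assumes "decreasing \<omega> xs" "decreasing \<omega> js" "set xs = set js"
  shows "xs = js"
proof -
  have *: "sorted_wrt (<) (map (\<lambda>i. - \<omega> i) xs)" if "decreasing \<omega> xs" for "xs"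
    using that by (simp add: decreasing_def sorted_wrt_map)
  have "inj_on (\<lambda>i. - \<omega> i) (set xs \<union> set js)"
    using *[OF assms(1)] assms(3) by (simp add: strict_sorted_iff distinct_map)
  then show ?thesis
    using *[OF assms(1)] *[OF assms(2)] assms(3) 
    by (intro map_sorted_distinct_set_unique[of "\<lambda>i. - \<omega> i"]) (simp_all add: strict_sorted_iff)
qed

lemma decreasing_measurable:
  assumes "sets M = sets borel" "set xs \<subseteq> I"
  shows "{\<omega> \<in> space (Pi\<^sub>M I (\<lambda>_. M)). decreasing \<omega> xs} \<in> sets (Pi\<^sub>M I (\<lambda>_. M))"
proof -
  have [measurable_cong]: "sets M = sets borel" by fact
  have [measurable]: "(\<lambda>\<omega>. \<omega> i) \<in> measurable (Pi\<^sub>M I (\<lambda>_. M)) M" if "i \<in> I" for i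
    using that by (rule measurable_component_singleton)
  show ?thesis
    using assms(2)
  proof (induction xs)
    case (Cons x xs)
    have "{\<omega> \<in> space (Pi\<^sub>M I (\<lambda>_. M)). (\<forall>y\<in>set xs. \<omega> y < \<omega> x) \<and> decreasing \<omega> xs}
        \<in> sets (Pi\<^sub>M I (\<lambda>_. M))"
    proof (intro sets.sets_Collect_conj sets.sets_Collect_finite_All)
      fix y assume "y \<in> set xs"
      then have [simp]: "x \<in> I" "y \<in> I" using Cons.prems by auto
      show "{\<omega> \<in> space (Pi\<^sub>M I (\<lambda>_. M)). \<omega> y < \<omega> x} \<in> sets (Pi\<^sub>M I (\<lambda>_. M))"
        by measurable
    qed (use Cons in auto)
    then show ?case by (simp add: decreasing_def)
  qed (simp add: decreasing_def)
qed

text \<open>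
  The probability of a decreasing order depends only on the number of coordinates involved, which
  therefore may be taken to be \<open>0, 1, 2, \<dots>\<close>.
\<close>

lemma measure_decreasing_eq:
  assumes M: "prob_space M" "sets M = sets borel"
    and xs: "distinct xs" "set xs \<subseteq> I"
  shows "measure (Pi\<^sub>M I (\<lambda>_. M)) {\<omega> \<in> space (Pi\<^sub>M I (\<lambda>_. M)). decreasing \<omega> xs} =
    measure (Pi\<^sub>M {..<length xs} (\<lambda>_. M))
      {\<omega> \<in> space (Pi\<^sub>M {..<length xs} (\<lambda>_. M)). decreasing \<omega> [0..<length xs]}"
    (is "_ = measure ?Q ?D")
proof -
  let ?P = "Pi\<^sub>M I (\<lambda>_. M)" and ?T = "\<lambda>\<omega>. \<lambda>i\<in>{..<length xs}. \<omega> (xs ! i)"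
  have T: "?T \<in> measurable ?P ?Q"
    using xs by (intro measurable_restrict measurable_component_singleton) auto
  have "distr ?P ?Q ?T = ?Q"
    using xs M by (intro distr_PiM_reindex) (auto simp: inj_on_def nth_eq_iff_index_eq)
  then have "measure ?Q ?D = measure (distr ?P ?Q ?T) ?D"
    by simp
  also have "\<dots> = measure ?P (?T -` ?D \<inter> space ?P)"
    using M T by (intro measure_distr decreasing_measurable) auto
  also have "?T -` ?D \<inter> space ?P = {\<omega> \<in> space ?P. decreasing \<omega> xs}"
    using measurable_space[OF T] xs
    by (auto simp: decreasing_def sorted_wrt_iff_nth_less)
  finally show ?thesis by simp
qed

text \<open>
  The \<open>k!\<close> orders in which \<open>k\<close> coordinates can be decreasing are disjoint events of the same probability.
\<close>

lemma measure_decreasing_le: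
  assumes M: "prob_space M" "sets M = sets borel" and xs: "set xs \<subseteq> I"
  shows "measure (Pi\<^sub>M I (\<lambda>_. M)) {\<omega> \<in> space (Pi\<^sub>M I (\<lambda>_. M)). decreasing \<omega> xs} \<le> 1 / fact (length xs)"
proof (cases "distinct xs")
  case False
  then have "{\<omega> \<in> space (Pi\<^sub>M I (\<lambda>_. M)). decreasing \<omega> xs} = {}"
    using decreasing_distinct by auto
  then show ?thesis by (simp del: Collect_empty_eq)
next
  case True
  define k where "k = length xs"
  let ?Q = "Pi\<^sub>M {..<k} (\<lambda>_. M)"
  let ?D = "\<lambda>js. {\<omega> \<in> space ?Q. decreasing \<omega> js}"
  let ?S = "permutations_of_set {..<k}"
  interpret Q: prob_space ?Q using M by (intro prob_space_PiM)
  have perm: "distinct js" "length js = k" "set js = {..<k}" if "js \<in> ?S" for js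
    using permutations_of_setD[OF that] length_finite_permutations_of_set[OF that] by auto
  have "fact k * measure ?Q (?D [0..<k]) = (\<Sum>js\<in>?S. measure ?Q (?D [0..<k]))"
    by simp
  also have "\<dots> = (\<Sum>js\<in>?S. measure ?Q (?D js))"
    using measure_decreasing_eq[OF M perm(1), of _ "{..<k}"] perm by (intro sum.cong) simp_all
  also have "\<dots> = measure ?Q (\<Union>js\<in>?S. ?D js)"
  proof (rule measure_finite_Union[symmetric])
    show "disjoint_family_on ?D ?S"
      unfolding disjoint_family_on_def using decreasing_unique perm(3) by blast
    show "?D ` ?S \<subseteq> sets ?Q"
      using M perm(3) by (auto intro!: decreasing_measurable)
  qed (simp_all add: Q.emeasure_finite)
  also have "\<dots> \<le> 1" by simp
  finally show ?thesis
    using measure_decreasing_eq[OF M True xs] by (simp add: k_def field_simps)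
qed


section \<open>The order in which edges ring\<close>

lemma rings_until_props:
  assumes "finite (edges G)"
  shows "set (rings_until G \<tau> t) = {e \<in> edges G. \<tau> e \<le> t}"
    and "distinct (rings_until G \<tau> t)" and "sorted (map \<tau> (rings_until G \<tau> t))"
proof -
  have "finite {e \<in> edges G. \<tau> e \<le> t}" using assms by simp
  then obtain es where "set es = {e \<in> edges G. \<tau> e \<le> t}" "distinct es"
    using finite_distinct_list by blast
  then have "\<exists>es. set es = {e \<in> edges G. \<tau> e \<le> t} \<and> distinct es \<and> sorted (map \<tau> es)"
    by (intro exI[of _ "sort_key \<tau> es"]) simp
  from someI_ex[OF this]
  show "set (rings_until G \<tau> t) = {e \<in> edges G. \<tau> e \<le> t}"
    "distinct (rings_until G \<tau> t)" "sorted (map \<tau> (rings_until G \<tau> t))"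
    by (auto simp: rings_until_def)
qed

text \<open>
  Without ties, the list of ringing edges is determined by its elements.
\<close>

lemma rings_until_eqI:
  assumes "finite (edges G)" "inj_on \<tau> (edges G)"
    and "set es = {e \<in> edges G. \<tau> e \<le> t}" "distinct es" "sorted (map \<tau> es)"
  shows "rings_until G \<tau> t = es"
proof (rule map_sorted_distinct_set_unique[of \<tau>])
  note r = rings_until_props[OF assms(1), of \<tau> t]
  show "inj_on \<tau> (set (rings_until G \<tau> t) \<union> set es)"
    using assms(2,3) r by (auto intro: inj_on_subset)
  then show "distinct (map \<tau> (rings_until G \<tau> t))" "distinct (map \<tau> es)"
    using r assms by (auto simp: distinct_map inj_on_Un)
qed (use rings_until_props[OF assms(1), of \<tau> t] assms in auto)


section \<open>A common form of the two processes\<close>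

text \<open>
  Every vertex starts in state \<open>c\<close>. A ringing edge whose ends are all in state \<open>c\<close> changes both of them
  to \<open>c'\<close>, or only the attacked one if \<open>both\<close> does not hold. Dimer RSA is the case of both ends with
  \<open>c = 0\<close> and \<open>c' = 1\<close>, the annihilation process that of one end with \<open>c = 1\<close> and \<open>c' = 0\<close>.
\<close>

locale flip_rule =
  fixes both :: bool and c c' :: nat
  assumes flip: "c' \<noteq> c"
begin

definition step :: "('v set \<Rightarrow> 'v) \<Rightarrow> 'v set \<Rightarrow> ('v \<Rightarrow> nat) \<Rightarrow> 'v \<Rightarrow> nat" where
  "step d e x =
    (if \<forall>u\<in>e. x u = c then (\<lambda>v. if v \<in> (if both then e else {d e}) then c' else x v) else x)"

definition run :: "'v graph \<Rightarrow> ('v set \<Rightarrow> real) \<Rightarrow> ('v set \<Rightarrow> 'v) \<Rightarrow> real \<Rightarrow> 'v \<Rightarrow> nat" where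
  "run G \<tau> d t = fold (step d) (rings_until G \<tau> t) (\<lambda>_. c)"

definition process :: "'v graph \<Rightarrow> ('v set \<Rightarrow> real) \<Rightarrow> ('v set \<Rightarrow> 'v) \<Rightarrow> real \<Rightarrow> 'v \<Rightarrow> nat" where
  "process G \<tau> d t v =
    (if finite (verts G) then run G \<tau> d t v
     else exhaustion_lim (verts G) (\<lambda>U. run (induced_subgraph G U) \<tau> d t v))"

lemma step_apply:
  "step d e x v = (if (\<forall>u\<in>e. x u = c) \<and> v \<in> (if both then e else {d e}) then c' else x v)"
  by (auto simp: step_def)

lemma step_keeps_flipped: "x v \<noteq> c \<Longrightarrow> step d e x v \<noteq> c"
  using flip by (simp add: step_def)

text \<open>
  Only edges in a set \<open>C\<close> that contains the edges at \<open>v\<close>, and with each edge all earlier ones that meet it,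
  influence the state of \<open>v\<close>. The induction removes the last ring: if it is outside \<open>C\<close>, it does not touch
  \<open>v\<close>; if it is in \<open>C\<close>, all earlier rings at its ends are in \<open>C\<close>, so that the two runs agree there.
\<close>

lemma fold_step_influence:
  assumes "\<And>e. e \<in> set es \<Longrightarrow> d e \<in> e"
    and "sorted_wrt (\<lambda>e f. \<tau> e < \<tau> f) es"
    and "\<And>e f. e \<in> C \<Longrightarrow> f \<in> set es \<Longrightarrow> e \<inter> f \<noteq> {} \<Longrightarrow> \<tau> f < \<tau> e \<Longrightarrow> f \<in> C"
    and "\<And>e. e \<in> set es \<Longrightarrow> v \<in> e \<Longrightarrow> e \<in> C"
  shows "fold (step d) es x v = fold (step d) (filter (\<lambda>e. e \<in> C) es) x v"
  using assms
proof (induction es arbitrary: v rule: rev_induct)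
  case (snoc e es)
  define y where "y = fold (step d) es x"
  define z where "z = fold (step d) (filter (\<lambda>e. e \<in> C) es) x"
  have IH: "y u = z u" if "\<And>f. f \<in> set es \<Longrightarrow> u \<in> f \<Longrightarrow> f \<in> C" for u
    unfolding y_def z_def
  proof (rule snoc.IH)
    show "f' \<in> C" if "e' \<in> C" "f' \<in> set es" "e' \<inter> f' \<noteq> {}" "\<tau> f' < \<tau> e'" for e' f'
      using snoc.prems(3)[of e' f'] that by simp
  qed (use snoc.prems that in \<open>auto simp: sorted_wrt_append\<close>)
  have v: "y v = z v"
    using snoc.prems(4) by (intro IH) auto
  show ?case
  proof (cases "e \<in> C")
    case False
    then have "v \<notin> e" using snoc.prems(4)[of e] by auto
    moreover have "d e \<in> e" using snoc.prems(1) by simp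
    ultimately have "step d e y v = y v" by (auto simp: step_def)
    with False v show ?thesis by (simp add: y_def z_def)
  next
    case True
    have "y u = z u" if "u \<in> e" for u
    proof (rule IH)
      fix f assume f: "f \<in> set es" "u \<in> f"
      then have "\<tau> f < \<tau> e" using snoc.prems(2) by (auto simp: sorted_wrt_append)
      then show "f \<in> C" using snoc.prems(3)[OF True, of f] f that by auto
    qed
    then have "step d e y v = step d e z v"
      using v by (auto simp: step_def)
    with True show ?thesis by (simp add: y_def z_def)
  qed
qed simp

end


section \<open>Limits along finite vertex sets\<close>

text \<open>
  Convergence along the directed set of finite subsets of \<open>V\<close>. For countable \<open>V\<close> this is the same as
  convergence to a common limit along all exhausting sequences, but it only involves countably many sets,
  which makes it accessible to measure theory, and one can pass to a larger set to treat several limits at once.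
\<close>

definition stabilises :: "'v set \<Rightarrow> ('v set \<Rightarrow> nat) \<Rightarrow> nat \<Rightarrow> bool" where
  "stabilises V f x \<longleftrightarrow> (\<exists>A\<in>Fpow V. \<forall>U\<in>Fpow V. A \<subseteq> U \<longrightarrow> f U = x)"

lemma stabilises_unique: "stabilises V f x \<Longrightarrow> stabilises V f y \<Longrightarrow> x = y"
proof -
  assume "stabilises V f x" "stabilises V f y"
  then obtain A B where A: "A \<in> Fpow V" "\<And>U. U \<in> Fpow V \<Longrightarrow> A \<subseteq> U \<Longrightarrow> f U = x"
    and B: "B \<in> Fpow V" "\<And>U. U \<in> Fpow V \<Longrightarrow> B \<subseteq> U \<Longrightarrow> f U = y"
    unfolding stabilises_def by blast
  then have "A \<union> B \<in> Fpow V" by (auto simp: Fpow_def)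
  then show "x = y" using A(2)[of "A \<union> B"] B(2)[of "A \<union> B"] by auto
qed

text \<open>
  If \<open>f\<close> does not stabilise at \<open>x\<close>, then every finite subset of \<open>V\<close> has a finite superset on which \<open>f\<close> differs from \<open>x\<close>,
  and such supersets of larger and larger finite sets form an exhausting sequence that contradicts convergence.
\<close>

lemma stabilises_iff_exhausts:
  assumes "countable V"
  shows "stabilises V f x \<longleftrightarrow> (\<forall>U. exhausts U V \<longrightarrow> (\<lambda>n. f (U n)) \<longlonglongrightarrow> x)"
proof safe
  fix U assume "stabilises V f x" and U: "exhausts U V"
  then obtain A where A: "A \<in> Fpow V" "\<And>U. U \<in> Fpow V \<Longrightarrow> A \<subseteq> U \<Longrightarrow> f U = x"
    unfolding stabilises_def by blast
  have "\<forall>\<^sub>F n in sequentially. \<forall>a\<in>A. a \<in> U n"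
  proof (intro eventually_ball_finite ballI)
    fix a assume "a \<in> A"
    with A U have "a \<in> (\<Union>n. \<Inter>m\<in>{n..}. U m)"
      by (auto simp: Fpow_def exhausts_def)
    then show "\<forall>\<^sub>F n in sequentially. a \<in> U n"
      by (auto simp: eventually_sequentially)
  qed (use A in \<open>auto simp: Fpow_def\<close>)
  then have "\<forall>\<^sub>F n in sequentially. f (U n) = x"
  proof eventually_elim
    case (elim n)
    have "U n \<in> Fpow V" using U by (simp add: exhausts_def Fpow_def)
    then show ?case using elim by (intro A(2)) auto
  qed
  then show "(\<lambda>n. f (U n)) \<longlonglongrightarrow> x" by (rule tendsto_eventually)
next
  assume lim: "\<forall>U. exhausts U V \<longrightarrow> (\<lambda>n. f (U n)) \<longlonglongrightarrow> x"
  show "stabilises V f x"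
  proof (rule ccontr)
    assume "\<not> stabilises V f x"
    then have bad: "\<exists>U\<in>Fpow V. A \<subseteq> U \<and> f U \<noteq> x" if "A \<in> Fpow V" for A
      using that unfolding stabilises_def by blast
    \<comment> \<open>Finite sets increasing to \<open>V\<close>; the exhausting sequence consists of bad supersets of them.\<close>
    define A where "A n = {v \<in> V. to_nat_on V v \<le> n}" for n
    have "finite (A n)" for n
    proof (rule finite_imageD)
      show "finite (to_nat_on V ` A n)"
        by (rule finite_subset[of _ "{..n}"]) (auto simp: A_def)
      show "inj_on (to_nat_on V) (A n)"
        using inj_on_to_nat_on[OF assms] by (rule inj_on_subset) (auto simp: A_def)
    qed
    then have "A n \<in> Fpow V" for n by (auto simp: A_def Fpow_def)
    with bad have "\<forall>n. \<exists>U. U \<in> Fpow V \<and> A n \<subseteq> U \<and> f U \<noteq> x" by blast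
    then obtain U where U: "\<And>n. U n \<in> Fpow V" "\<And>n. A n \<subseteq> U n" "\<And>n. f (U n) \<noteq> x"
      by metis
    have "v \<in> (\<Union>n. \<Inter>m\<in>{n..}. U m)" if "v \<in> V" for v
      using that U(2) by (intro UN_I[of "to_nat_on V v"]) (auto simp: A_def)
    then have "exhausts U V"
      using U(1) by (auto simp: exhausts_def Fpow_def)
    with lim have "(\<lambda>n. f (U n)) \<longlonglongrightarrow> x" by blast
    then have "\<forall>\<^sub>F n in sequentially. f (U n) = x"
      by (simp add: tendsto_discrete)
    with U(3) show False by simp
  qed
qed

lemma exhaustion_lim_eq_The:
  "countable V \<Longrightarrow> exhaustion_lim V f = (THE x. stabilises V f x)"
  by (simp add: exhaustion_lim_def stabilises_iff_exhausts)

lemma exhaustion_lim_eqI: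
  "countable V \<Longrightarrow> stabilises V f x \<Longrightarrow> exhaustion_lim V f = x"
  unfolding exhaustion_lim_eq_The by (blast intro: the_equality stabilises_unique)

lemma induced_subgraph_verts: "simple_graph G \<Longrightarrow> induced_subgraph G (verts G) = G"
  by (cases G) (auto simp: induced_subgraph_def simple_graph_def)

lemma finite_edges_induced_subgraph: "finite U \<Longrightarrow> finite (edges (induced_subgraph G U))"
  by (rule finite_subset[of _ "Pow U"]) (auto simp: induced_subgraph_def)

lemma (in flip_rule) process_eqI:
  assumes "simple_graph G" "countable (verts G)"
    and "stabilises (verts G) (\<lambda>U. run (induced_subgraph G U) \<tau> d t v) x"
  shows "process G \<tau> d t v = x"
proof (cases "finite (verts G)")
  case True
  then have "verts G \<in> Fpow (verts G)" by (simp add: Fpow_def)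
  with assms(3) have "run (induced_subgraph G (verts G)) \<tau> d t v = x"
    unfolding stabilises_def by (auto simp: Fpow_def)
  with True assms(1) show ?thesis by (simp add: process_def induced_subgraph_verts)
next
  case False
  with assms show ?thesis by (simp add: process_def exhaustion_lim_eqI)
qed


section \<open>Decreasing paths of edges\<close>

text \<open>
  The routes along which influence spreads to \<open>v\<close>. They need not be walks in the graph: consecutive edges
  of a list only have to meet, so that several of them may share one vertex.
\<close>

definition edge_paths :: "'v set set \<Rightarrow> 'v \<Rightarrow> nat \<Rightarrow> 'v set list set" where
  "edge_paths E v k = {es. length es = k \<and> set es \<subseteq> E \<and> (es \<noteq> [] \<longrightarrow> v \<in> hd es) \<and>
    successively (\<lambda>e f. e \<inter> f \<noteq> {}) es}"

lemma edge_paths_snoc: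
  "es @ [f] \<in> edge_paths E v (Suc k) \<longleftrightarrow>
    es \<in> edge_paths E v k \<and> f \<in> E \<and> (if es = [] then v \<in> f else last es \<inter> f \<noteq> {})"
  by (auto simp: edge_paths_def successively_append_iff)

text \<open>
  A path can be prolonged by at most \<open>D\<close> edges at each of the two ends of its last edge.
\<close>

lemma card_edge_paths:
  assumes deg: "\<And>u. finite {e \<in> E. u \<in> e} \<and> card {e \<in> E. u \<in> e} \<le> D"
    and E: "\<And>e. e \<in> E \<Longrightarrow> card e = 2"
  shows "finite (edge_paths E v k) \<and> card (edge_paths E v k) \<le> (2 * D) ^ k"
proof (induction k)
  case 0
  have "edge_paths E v 0 = {[]}" by (auto simp: edge_paths_def)
  then show ?case by simp
next
  case (Suc k)
  \<comment> \<open>The edges by which the path \<open>es\<close> can be prolonged.\<close>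
  define N where "N es = (if es = [] then {e \<in> E. v \<in> e} else \<Union>u\<in>last es. {e \<in> E. u \<in> e})" for es
  have N: "finite (N es) \<and> card (N es) \<le> 2 * D" if "es \<in> edge_paths E v k" for es
  proof (cases "es = []")
    case True
    then show ?thesis using deg[of v] by (simp add: N_def)
  next
    case False
    then have "last es \<in> E" using that last_in_set[OF False] by (auto simp: edge_paths_def)
    with E have l: "card (last es) = 2" "finite (last es)" by (auto intro: card_ge_0_finite)
    have "card (\<Union>u\<in>last es. {e \<in> E. u \<in> e}) \<le> (\<Sum>u\<in>last es. card {e \<in> E. u \<in> e})"
      using l by (intro card_UN_le)
    also have "\<dots> \<le> (\<Sum>u\<in>last es. D)" using deg by (intro sum_mono) auto
    finally show ?thesis using False l deg by (simp add: N_def)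
  qed
  have sub: "edge_paths E v (Suc k) \<subseteq> (\<lambda>(es, f). es @ [f]) ` (SIGMA es:edge_paths E v k. N es)"
  proof
    fix fs assume fs: "fs \<in> edge_paths E v (Suc k)"
    then have "fs \<noteq> []" by (auto simp: edge_paths_def)
    then obtain es f where fs_eq: "fs = es @ [f]" by (metis rev_exhaust)
    with fs have "es \<in> edge_paths E v k" "f \<in> N es"
      by (auto simp: edge_paths_snoc N_def split: if_splits)
    with fs_eq show "fs \<in> (\<lambda>(es, f). es @ [f]) ` (SIGMA es:edge_paths E v k. N es)" by force
  qed
  have fin: "finite (SIGMA es:edge_paths E v k. N es)"
    using Suc N by (intro finite_SigmaI) auto
  have "card (edge_paths E v (Suc k)) \<le> card (SIGMA es:edge_paths E v k. N es)"
    using card_mono[OF finite_imageI[OF fin] sub] card_image_le[OF fin] by (rule le_trans)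
  also have "\<dots> = (\<Sum>es\<in>edge_paths E v k. card (N es))"
    using Suc N by (intro card_SigmaI) auto
  also have "\<dots> \<le> (\<Sum>es\<in>edge_paths E v k. 2 * D)"
    using N by (intro sum_mono) auto
  also have "\<dots> \<le> (2 * D) ^ Suc k" using Suc by simp
  finally show ?case using finite_subset[OF sub] fin by blast
qed

text \<open>
  The expected number of decreasing paths of \<open>k\<close> edges is at most \<open>(2 D)^k / k!\<close>, which tends to \<open>0\<close>.
\<close>

lemma AE_no_long_decreasing_path:
  assumes M: "prob_space M" "sets M = sets borel"
    and deg: "\<And>u. finite {e \<in> E. u \<in> e} \<and> card {e \<in> E. u \<in> e} \<le> D"
    and E: "\<And>e. e \<in> E \<Longrightarrow> card e = 2"
  shows "AE \<omega> in Pi\<^sub>M E (\<lambda>_. M). \<exists>k. \<forall>es\<in>edge_paths E v k. \<not> decreasing \<omega> es"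
proof -
  let ?P = "Pi\<^sub>M E (\<lambda>_. M)"
  interpret P: prob_space ?P using M by (intro prob_space_PiM)
  define B where "B k = (\<Union>es\<in>edge_paths E v k. {\<omega> \<in> space ?P. decreasing \<omega> es})" for k
  note paths = card_edge_paths[OF deg E, where v = v]
  have sub: "set es \<subseteq> E" "length es = k" if "es \<in> edge_paths E v k" for es k
    using that by (auto simp: edge_paths_def)
  have meas: "{\<omega> \<in> space ?P. decreasing \<omega> es} \<in> sets ?P" if "es \<in> edge_paths E v k" for es k
    using M sub[OF that] by (intro decreasing_measurable)
  then have B: "B k \<in> sets ?P" for k
    unfolding B_def using paths by (intro sets.finite_UN) auto
  have le: "measure ?P (B k) \<le> real (2 * D) ^ k /\<^sub>R fact k" for k
  proof -
    have "measure ?P (B k) \<le> (\<Sum>es\<in>edge_paths E v k. measure ?P {\<omega> \<in> space ?P. decreasing \<omega> es})"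
      unfolding B_def using paths meas by (intro P.finite_measure_subadditive_finite) auto
    also have "\<dots> \<le> (\<Sum>es\<in>edge_paths E v k. 1 / fact k)"
    proof (rule sum_mono)
      fix es assume "es \<in> edge_paths E v k"
      from measure_decreasing_le[OF M sub(1)[OF this]] sub(2)[OF this]
      show "measure ?P {\<omega> \<in> space ?P. decreasing \<omega> es} \<le> 1 / fact k" by simp
    qed
    also have "\<dots> = real (card (edge_paths E v k)) / fact k" by simp
    also have "\<dots> \<le> real ((2 * D) ^ k) / fact k"
      using conjunct2[OF paths[of k]] by (intro divide_right_mono of_nat_mono) simp_all
    finally show ?thesis by (simp add: field_simps)
  qed
  have "(\<lambda>k. real (2 * D) ^ k /\<^sub>R fact k) \<longlonglongrightarrow> 0"
    using summable_exp_generic by (rule summable_LIMSEQ_zero)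
  moreover have "measure ?P (\<Inter>k. B k) \<le> real (2 * D) ^ k /\<^sub>R fact k" for k
    using P.finite_measure_mono[of "\<Inter>k. B k" "B k"] B le[of k] by (meson INT_lower UNIV_I order_trans)
  ultimately have "measure ?P (\<Inter>k. B k) \<le> 0"
    by (intro LIMSEQ_le_const) auto
  then have null: "emeasure ?P (\<Inter>k. B k) = 0"
    by (simp add: P.emeasure_eq_measure antisym)
  show ?thesis
  proof (rule AE_I[OF _ null])
    show "{\<omega> \<in> space ?P. \<not> (\<exists>k. \<forall>es\<in>edge_paths E v k. \<not> decreasing \<omega> es)} \<subseteq> (\<Inter>k. B k)"
      by (auto simp: B_def)
    show "(\<Inter>k. B k) \<in> sets ?P" using B by auto
  qed
qed


section \<open>Stabilisation on a graph of bounded degree\<close>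

definition randomness :: "'v graph \<Rightarrow> (('v set \<Rightarrow> real) \<times> ('v set \<Rightarrow> 'v)) measure" where
  "randomness G = ring_times G \<Otimes>\<^sub>M attacks G"

lemma prob_space_ring_time: "prob_space (uniform_measure lborel {0<..<1::real})"
  by (rule prob_space_uniform_measure) simp_all

lemma prob_space_ring_times: "prob_space (ring_times G)"
  unfolding ring_times_def by (intro prob_space_PiM prob_space_ring_time)

lemma prob_space_attacks: "prob_space (attacks G)"
  unfolding attacks_def by (intro prob_space_PiM prob_space_measure_pmf)

lemma AE_pair_fst:
  assumes "prob_space N" "AE x in M. P x"
  shows "AE \<omega> in M \<Otimes>\<^sub>M N. P (fst \<omega>)"
proof (rule AE_distrD[OF measurable_fst])
  show "AE x in distr (M \<Otimes>\<^sub>M N) M fst. P x"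
    unfolding prob_space.distr_pair_fst[OF assms(1)] by fact
qed

lemma AE_pair_snd:
  assumes "prob_space M" "prob_space N" "AE y in N. P y"
  shows "AE \<omega> in M \<Otimes>\<^sub>M N. P (snd \<omega>)"
proof -
  interpret M: prob_space M by fact
  interpret N: prob_space N by fact
  interpret swap: pair_sigma_finite N M ..
  have "AE \<omega> in N \<Otimes>\<^sub>M M. P (fst \<omega>)" using assms by (intro AE_pair_fst)
  then have "AE \<omega> in distr (M \<Otimes>\<^sub>M N) (N \<Otimes>\<^sub>M M) (\<lambda>(x, y). (y, x)). P (fst \<omega>)"
    unfolding swap.distr_pair_swap[symmetric] .
  then have "AE \<omega> in M \<Otimes>\<^sub>M N. P (fst (case \<omega> of (x, y) \<Rightarrow> (y, x)))"
    by (rule AE_distrD[rotated]) simp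
  then show ?thesis by (simp add: case_prod_beta)
qed

text \<open>
  Bounding the number of edges at a vertex instead of the number of its neighbours makes the condition easy
  to transfer to the split graph, whose edges are in bijection with those of the original one.
\<close>

definition locally_bounded :: "'v graph \<Rightarrow> bool" where
  "locally_bounded G \<longleftrightarrow> (\<exists>D. \<forall>v. finite {e \<in> edges G. v \<in> e} \<and> card {e \<in> edges G. v \<in> e} \<le> D)"

lemma countable_edges:
  assumes "simple_graph G" "countable (verts G)"
  shows "countable (edges G)"
proof (rule countable_subset[OF _ countable_Fpow[OF assms(2)]])
  show "edges G \<subseteq> Fpow (verts G)"
    using assms(1) by (auto simp: simple_graph_def Fpow_def intro: card_ge_0_finite)
qed

lemma AE_inj_ring_times:
  assumes "simple_graph G" "countable (verts G)"
  shows "AE \<tau> in ring_times G. inj_on \<tau> (edges G)"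
  unfolding ring_times_def
proof (rule AE_PiM_inj_on[OF prob_space_ring_time])
  show "AE y in uniform_measure lborel {0<..<1}. y \<noteq> x" for x :: real
    using AE_lborel_singleton[of x] by (intro AE_uniform_measureI) (auto elim!: eventually_mono)
qed (use countable_edges[OF assms] in simp_all)

lemma AE_attacks_mem:
  assumes "simple_graph G" "countable (verts G)"
  shows "AE d in attacks G. \<forall>e\<in>edges G. d e \<in> e"
proof -
  have "AE d in attacks G. d e \<in> e" if e: "e \<in> edges G" for e
    unfolding attacks_def
  proof (rule AE_PiM_component[OF prob_space_measure_pmf e])
    have "card e = 2" using assms(1) e by (simp add: simple_graph_def)
    then have "finite e" "e \<noteq> {}" by (auto intro: card_ge_0_finite)
    then show "AE v in measure_pmf (pmf_of_set e). v \<in> e"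
      by (simp add: AE_measure_pmf_iff)
  qed
  then show ?thesis
    using countable_edges[OF assms] by (simp add: AE_ball_countable)
qed

text \<open>
  The last edges of the decreasing paths from \<open>v\<close> form a set \<open>C\<close> to which \<open>fold_step_influence\<close>
  applies. Initial segments of decreasing paths are decreasing paths, so without such paths of length \<open>k\<close> all
  of them are shorter, and \<open>C\<close> is finite. As soon as a vertex set contains all ends of the edges
  in \<open>C\<close>, enlarging it has no effect on \<open>v\<close>.
\<close>

lemma (in flip_rule) run_stabilises:
  assumes G: "simple_graph G" and v: "v \<in> verts G"
    and \<tau>: "inj_on \<tau> (edges G)" and d: "\<And>e. e \<in> edges G \<Longrightarrow> d e \<in> e"
    and fin: "\<And>j. finite (edge_paths (edges G) v j)"
    and short: "\<And>es. es \<in> edge_paths (edges G) v k \<Longrightarrow> \<not> decreasing \<tau> es"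
  shows "\<exists>x. stabilises (verts G) (\<lambda>U. run (induced_subgraph G U) \<tau> d t v) x"
proof -
  define C where "C = {last es | es. es \<noteq> [] \<and> decreasing \<tau> es \<and> (\<exists>j. es \<in> edge_paths (edges G) v j)}"
  \<comment> \<open>The empty list is a decreasing path of length \<open>0\<close>.\<close>
  have "k \<noteq> 0"
    using short[of "[]"] by (auto simp: edge_paths_def decreasing_def intro!: Nat.gr0I)
  have "C \<subseteq> last ` (\<Union>j<k. edge_paths (edges G) v j)"
  proof
    fix e assume "e \<in> C"
    then obtain es j where es: "e = last es" "decreasing \<tau> es" "es \<in> edge_paths (edges G) v j" "es \<noteq> []"
      by (auto simp: C_def)
    \<comment> \<open>Otherwise the first \<open>k\<close> edges form a decreasing path of length \<open>k\<close>.\<close>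
    have "j < k"
    proof (rule ccontr)
      assume "\<not> j < k"
      have "successively (\<lambda>e f. e \<inter> f \<noteq> {}) (take k es @ drop k es)"
        using es by (simp add: edge_paths_def)
      then have "successively (\<lambda>e f. e \<inter> f \<noteq> {}) (take k es)"
        unfolding successively_append_iff by blast
      then have "take k es \<in> edge_paths (edges G) v k"
        using es \<open>k \<noteq> 0\<close> \<open>\<not> j < k\<close> set_take_subset[of k es] by (auto simp: edge_paths_def)
      moreover have "decreasing \<tau> (take k es)"
        using es by (simp add: decreasing_def sorted_wrt_take)
      ultimately show False using short by blast
    qed
    with es show "e \<in> last ` (\<Union>j<k. edge_paths (edges G) v j)" by blast
  qed
  then have finC: "finite C" by (rule finite_subset) (simp add: fin)
  have CE: "C \<subseteq> edges G"
    unfolding C_def edge_paths_def by (auto dest: last_in_set)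
  have edge: "finite e" "e \<subseteq> verts G" if "e \<in> edges G" for e
    using G that by (auto simp: simple_graph_def intro: card_ge_0_finite)
  \<comment> \<open>On any finite vertex set that contains \<open>A\<close>, only the edges in \<open>C\<close> matter for \<open>v\<close>; the run of the graph
    \<open>(A, C)\<close> thus gives the limit.\<close>
  define A where "A = insert v (\<Union>C)"
  have "A \<in> Fpow (verts G)"
    using finC CE edge v by (auto simp: A_def Fpow_def)
  moreover have "run (induced_subgraph G U) \<tau> d t v = fold (step d) (rings_until (A, C) \<tau> t) (\<lambda>_. c) v"
    if U: "U \<in> Fpow (verts G)" "A \<subseteq> U" for U
  proof -
    define H where "H = induced_subgraph G U"
    have H: "edges H = {e \<in> edges G. e \<subseteq> U}" by (simp add: H_def induced_subgraph_def)
    have finH: "finite (edges H)"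
      using U by (simp add: H_def Fpow_def finite_edges_induced_subgraph)
    have CH: "C \<subseteq> edges H" using CE U by (auto simp: H A_def)
    let ?r = "rings_until H \<tau> t"
    note r = rings_until_props[OF finH, of \<tau> t]
    have "distinct (map \<tau> ?r)"
      using r \<tau> by (auto simp: distinct_map H intro: inj_on_subset)
    then have sorted: "sorted_wrt (\<lambda>e f. \<tau> e < \<tau> f) ?r"
      using r by (simp add: strict_sorted_iff flip: sorted_wrt_map)
    have "run H \<tau> d t v = fold (step d) (filter (\<lambda>e. e \<in> C) ?r) (\<lambda>_. c) v"
      unfolding run_def
    proof (rule fold_step_influence[OF _ sorted])
      show "d e \<in> e" if "e \<in> set ?r" for e using that r d by (simp add: H)
    next
      fix e f assume "e \<in> C" and f: "f \<in> set ?r" "e \<inter> f \<noteq> {}" "\<tau> f < \<tau> e"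
      then obtain es j where es: "e = last es" "decreasing \<tau> es" "es \<in> edge_paths (edges G) v j" "es \<noteq> []"
        by (auto simp: C_def)
      have "decreasing \<tau> (butlast es @ [last es])" using es by simp
      then have "decreasing \<tau> ((butlast es @ [last es]) @ [f])"
        using f es(1) unfolding decreasing_def by (auto simp: sorted_wrt_append simp del: append_butlast_last_id)
      then have "decreasing \<tau> (es @ [f])" using es by simp
      moreover have "es @ [f] \<in> edge_paths (edges G) v (Suc j)"
        using es f r by (simp add: edge_paths_snoc H)
      ultimately show "f \<in> C" unfolding C_def by (auto intro!: exI[of _ "es @ [f]"])
    next
      fix f assume "f \<in> set ?r" "v \<in> f"
      then have "[f] \<in> edge_paths (edges G) v 1" using r by (simp add: edge_paths_def H)
      then show "f \<in> C" unfolding C_def by (auto simp: decreasing_def intro!: exI[of _ "[f]"])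
    qed
    also have "filter (\<lambda>e. e \<in> C) ?r = rings_until (A, C) \<tau> t"
    proof (rule rings_until_eqI[symmetric])
      show "inj_on \<tau> (edges (A, C))" using \<tau> CE by (auto intro: inj_on_subset)
      show "set (filter (\<lambda>e. e \<in> C) ?r) = {e \<in> edges (A, C). \<tau> e \<le> t}" using r CH by auto
      show "sorted (map \<tau> (filter (\<lambda>e. e \<in> C) ?r))" using r by (intro sorted_filter)
    qed (use finC r in auto)
    finally show ?thesis by (simp add: H_def)
  qed
  ultimately show ?thesis unfolding stabilises_def by blast
qed

lemma (in flip_rule) AE_run_stabilises:
  assumes G: "simple_graph G" "countable (verts G)" "locally_bounded G" and v: "v \<in> verts G"
  shows "AE \<omega> in randomness G.
    \<exists>x. stabilises (verts G) (\<lambda>U. run (induced_subgraph G U) (fst \<omega>) (snd \<omega>) t v) x"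
proof -
  obtain D where D: "\<And>v. finite {e \<in> edges G. v \<in> e} \<and> card {e \<in> edges G. v \<in> e} \<le> D"
    using G(3) unfolding locally_bounded_def by blast
  have E: "card e = 2" if "e \<in> edges G" for e
    using G(1) that by (simp add: simple_graph_def)
  have "AE \<tau> in ring_times G. \<exists>k. \<forall>es\<in>edge_paths (edges G) v k. \<not> decreasing \<tau> es"
    unfolding ring_times_def
    by (rule AE_no_long_decreasing_path[OF prob_space_ring_time _ D E]) simp_all
  with AE_inj_ring_times[OF G(1,2)]
  have "AE \<tau> in ring_times G. inj_on \<tau> (edges G) \<and>
      (\<exists>k. \<forall>es\<in>edge_paths (edges G) v k. \<not> decreasing \<tau> es)"
    by eventually_elim blast
  then have "AE \<omega> in randomness G. inj_on (fst \<omega>) (edges G) \<and>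
      (\<exists>k. \<forall>es\<in>edge_paths (edges G) v k. \<not> decreasing (fst \<omega>) es)"
    unfolding randomness_def by (rule AE_pair_fst[OF prob_space_attacks])
  moreover have "AE \<omega> in randomness G. \<forall>e\<in>edges G. snd \<omega> e \<in> e"
    unfolding randomness_def
    using prob_space_ring_times prob_space_attacks AE_attacks_mem[OF G(1,2)] by (rule AE_pair_snd)
  ultimately show ?thesis
  proof eventually_elim
    case (elim \<omega>)
    then obtain k where "\<And>es. es \<in> edge_paths (edges G) v k \<Longrightarrow> \<not> decreasing (fst \<omega>) es" by blast
    with elim show ?case
      using card_edge_paths[OF D E] by (intro run_stabilises[OF G(1) v]) auto
  qed
qed


section \<open>Measurability\<close>

text \<open>
  However the list of rings is chosen in case of ties, the choice depends on \<open>\<tau>\<close> only through the set of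
  edges that ring before \<open>t\<close> and the comparisons between ringing times. These are finitely many
  measurable data.
\<close>

lemma measurable_rings_until:
  fixes G H :: "'v graph"
  assumes H: "finite (edges H)" "edges H \<subseteq> edges G"
  shows "(\<lambda>\<tau>. rings_until H \<tau> t) \<in>
    measurable (ring_times G) (count_space {es. set es \<subseteq> edges H \<and> distinct es})"
proof -
  let ?E = "edges H" and ?M = "ring_times G"
  let ?A = "Pow ?E \<times> Pow (?E \<times> ?E)" and ?L = "{es. set es \<subseteq> ?E \<and> distinct es}"
  \<comment> \<open>The finite data \<open>r \<tau>\<close> on which the list depends, and the choice \<open>h\<close> of a list from them.\<close>
  define r where "r \<tau> = ({e \<in> ?E. \<tau> e \<le> t}, {(e, f) \<in> ?E \<times> ?E. \<tau> e \<le> \<tau> f})" for \<tau> :: "'v set \<Rightarrow> real"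
  define h where "h = (\<lambda>(S, R). SOME es :: 'v set list. set es = S \<and> distinct es \<and> sorted_wrt (\<lambda>e f. (e, f) \<in> R) es)"
  have rings: "rings_until H \<tau> t = h (r \<tau>)" for \<tau>
  proof -
    have "sorted (map \<tau> es) \<longleftrightarrow> sorted_wrt (\<lambda>e f. (e, f) \<in> snd (r \<tau>)) es" if "set es = fst (r \<tau>)" for es
      unfolding sorted_wrt_map using that by (intro iffI; elim sorted_wrt_mono_rel[rotated]) (auto simp: r_def)
    then have "(set es = fst (r \<tau>) \<and> distinct es \<and> sorted (map \<tau> es)) =
      (set es = fst (r \<tau>) \<and> distinct es \<and> sorted_wrt (\<lambda>e f. (e, f) \<in> snd (r \<tau>)) es)" for es
      by blast
    then show ?thesis by (simp add: rings_until_def h_def r_def)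
  qed
  have [measurable]: "(\<lambda>\<tau>. \<tau> e) \<in> borel_measurable ?M" if "e \<in> ?E" for e
  proof -
    have "(\<lambda>\<tau>. \<tau> e) \<in> measurable ?M (uniform_measure lborel {0<..<1})"
      unfolding ring_times_def using that H by (intro measurable_component_singleton) auto
    then show ?thesis by (simp cong: measurable_cong_sets)
  qed
  have r: "r \<in> measurable ?M (count_space ?A)"
  proof (subst measurable_count_space_eq2)
    show "finite ?A" using H by simp
    show "r \<in> space ?M \<rightarrow> ?A \<and> (\<forall>a\<in>?A. r -` {a} \<inter> space ?M \<in> sets ?M)"
    proof (intro conjI ballI)
      show "r \<in> space ?M \<rightarrow> ?A" by (auto simp: r_def)
      fix a assume a: "a \<in> ?A"
      have "r -` {a} \<inter> space ?M =
        {\<tau> \<in> space ?M. (\<forall>e\<in>?E. \<tau> e \<le> t \<longleftrightarrow> e \<in> fst a) \<and> (\<forall>e\<in>?E. \<forall>f\<in>?E. \<tau> e \<le> \<tau> f \<longleftrightarrow> (e, f) \<in> snd a)}"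
        using a by (cases a) (auto simp: r_def; blast)
      also have "\<dots> \<in> sets ?M"
      proof (intro sets.sets_Collect_conj sets.sets_Collect_finite_All H)
        fix e assume e[simp]: "e \<in> ?E"
        have le: "{\<tau> \<in> space ?M. \<tau> e \<le> t} \<in> sets ?M" by measurable
        show "{\<tau> \<in> space ?M. (\<tau> e \<le> t) = (e \<in> fst a)} \<in> sets ?M"
          using le sets.sets_Collect_neg[OF le] by (cases "e \<in> fst a") simp_all
        fix f assume f[simp]: "f \<in> ?E"
        have le: "{\<tau> \<in> space ?M. \<tau> e \<le> \<tau> f} \<in> sets ?M" by measurable
        show "{\<tau> \<in> space ?M. (\<tau> e \<le> \<tau> f) = ((e, f) \<in> snd a)} \<in> sets ?M"
          using le sets.sets_Collect_neg[OF le] by (cases "(e, f) \<in> snd a") simp_all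
      qed
      finally show "r -` {a} \<inter> space ?M \<in> sets ?M" .
    qed
  qed
  show ?thesis
  proof (subst measurable_count_space_eq2)
    show "finite ?L" using finite_subset_distinct[OF H(1)] by simp
    show "(\<lambda>\<tau>. rings_until H \<tau> t) \<in> space ?M \<rightarrow> ?L \<and>
      (\<forall>es\<in>?L. (\<lambda>\<tau>. rings_until H \<tau> t) -` {es} \<inter> space ?M \<in> sets ?M)"
    proof (intro conjI ballI)
      show "(\<lambda>\<tau>. rings_until H \<tau> t) \<in> space ?M \<rightarrow> ?L"
        using rings_until_props[OF H(1)] by auto
      fix es
      have "(\<lambda>\<tau>. rings_until H \<tau> t) -` {es} \<inter> space ?M = r -` {a \<in> ?A. h a = es} \<inter> space ?M"
        using measurable_space[OF r] by (auto simp: rings)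
      also have "\<dots> \<in> sets ?M" using r by (rule measurable_sets) auto
      finally show "(\<lambda>\<tau>. rings_until H \<tau> t) -` {es} \<inter> space ?M \<in> sets ?M" .
    qed
  qed
qed

context flip_rule
begin

lemma measurable_fold_step:
  assumes d: "\<And>e. e \<in> set es \<Longrightarrow> (\<lambda>\<omega>. D \<omega> e) \<in> measurable M (count_space UNIV)"
    and fin: "\<And>e. e \<in> set es \<Longrightarrow> finite e"
    and X: "\<And>v. (\<lambda>\<omega>. X \<omega> v) \<in> measurable M (count_space UNIV)"
  shows "(\<lambda>\<omega>. fold (step (D \<omega>)) es (X \<omega>) v) \<in> measurable M (count_space UNIV)"
  using assms
proof (induction es arbitrary: X v)
  case (Cons e es)
  have [measurable]: "(\<lambda>\<omega>. D \<omega> e) \<in> measurable M (count_space UNIV)"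
    "(\<lambda>\<omega>. X \<omega> v) \<in> measurable M (count_space UNIV)" for v
    using Cons.prems by auto
  have "(\<lambda>\<omega>. step (D \<omega>) e (X \<omega>) v) \<in> measurable M (count_space UNIV)" for v
  proof -
    have "Measurable.pred M (\<lambda>\<omega>. \<forall>u\<in>e. X \<omega> u = c)"
      using Cons.prems(2)[of e] by (intro pred_intros_finite) auto
    moreover have "Measurable.pred M (\<lambda>\<omega>. v \<in> (if both then e else {D \<omega> e}))"
      by (cases both) simp_all
    ultimately have "(\<lambda>\<omega>. if (\<forall>u\<in>e. X \<omega> u = c) \<and> v \<in> (if both then e else {D \<omega> e}) then c' else X \<omega> v)
        \<in> measurable M (count_space UNIV)"
      by measurable
    then show ?thesis by (simp only: step_apply)
  qed
  then show ?case
    using Cons by simp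
qed simp

lemma measurable_run:
  assumes G: "simple_graph G" and H: "finite (edges H)" "edges H \<subseteq> edges G"
  shows "(\<lambda>\<omega>. run H (fst \<omega>) (snd \<omega>) t v) \<in> measurable (randomness G) (count_space UNIV)"
proof -
  let ?L = "{es. set es \<subseteq> edges H \<and> distinct es}"
  have "(\<lambda>\<omega>. fold (step (snd \<omega>)) (rings_until H (fst \<omega>) t) (\<lambda>_. c) v)
    \<in> measurable (randomness G) (count_space UNIV)"
  proof (rule measurable_compose_countable'[where I = ?L and g = "\<lambda>\<omega>. rings_until H (fst \<omega>) t"])
    show "(\<lambda>\<omega>. rings_until H (fst \<omega>) t) \<in> measurable (randomness G) (count_space ?L)"
      using measurable_fst measurable_rings_until[OF H] unfolding randomness_def
      by (rule measurable_compose)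
    show "countable ?L" using finite_subset_distinct[OF H(1)] by (simp add: countable_finite)
    fix es assume es: "es \<in> ?L"
    show "(\<lambda>\<omega>. fold (step (snd \<omega>)) es (\<lambda>_. c) v) \<in> measurable (randomness G) (count_space UNIV)"
    proof (rule measurable_fold_step)
      fix e assume "e \<in> set es"
      then have e: "e \<in> edges G" using es H by auto
      then show "finite e" using G by (auto simp: simple_graph_def intro: card_ge_0_finite)
      have "(\<lambda>d. d e) \<in> measurable (attacks G) (measure_pmf (pmf_of_set e))"
        unfolding attacks_def using e by (intro measurable_component_singleton)
      then have "(\<lambda>d. d e) \<in> measurable (attacks G) (count_space UNIV)"
        by (simp cong: measurable_cong_sets)
      with measurable_snd show "(\<lambda>\<omega>. snd \<omega> e) \<in> measurable (randomness G) (count_space UNIV)"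
        unfolding randomness_def by (rule measurable_compose)
    qed simp
  qed
  then show ?thesis by (simp add: run_def)
qed

text \<open>
  On an infinite graph, where the limit does not exist, the process is the constant \<open>THE y. False\<close>. So the
  event is the union of the event that the runs stabilise at \<open>x\<close> and, if \<open>x\<close> is that constant, the event that they do not stabilise
  at all; both are countable combinations of events about runs on finite graphs.
\<close>

lemma sets_process_eq:
  assumes G: "simple_graph G" and V: "countable (verts G)"
  shows "{\<omega> \<in> space (randomness G). process G (fst \<omega>) (snd \<omega>) t v = x} \<in> sets (randomness G)"
proof (cases "finite (verts G)")
  case True
  have "finite (edges G)"
    using G True by (intro finite_subset[of "edges G" "Pow (verts G)"]) (auto simp: simple_graph_def)
  from measurable_sets[OF measurable_run[OF G this order_refl], of "{x}" t v] 
  show ?thesis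
    using True by (simp add: process_def vimage_def Int_def conj_commute)
next
  case False
  let ?M = "randomness G"
  define f where "f \<omega> U = run (induced_subgraph G U) (fst \<omega>) (snd \<omega>) t v" for \<omega> U
  have stab: "{\<omega> \<in> space ?M. stabilises (verts G) (f \<omega>) y} \<in> sets ?M" for y
    unfolding stabilises_def
  proof (intro sets.sets_Collect_countable_Ex' sets.sets_Collect_countable_All'
      sets.sets_Collect_imp sets.sets_Collect_const countable_Fpow V)
    fix U assume "U \<in> Fpow (verts G)"
    then have "finite (edges (induced_subgraph G U))" "edges (induced_subgraph G U) \<subseteq> edges G"
      by (simp add: Fpow_def finite_edges_induced_subgraph) (auto simp: induced_subgraph_def)
    from measurable_sets[OF measurable_run[OF G this], of "{y}" t v]
    show "{\<omega> \<in> space ?M. f \<omega> U = y} \<in> sets ?M"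
      by (simp add: f_def vimage_def Int_def conj_commute)
  qed
  have eq: "process G (fst \<omega>) (snd \<omega>) t v = x \<longleftrightarrow>
    stabilises (verts G) (f \<omega>) x \<or> ((\<forall>y. \<not> stabilises (verts G) (f \<omega>) y) \<and> x = (THE y. False))" for \<omega>
  proof (cases "\<exists>y. stabilises (verts G) (f \<omega>) y")
    case True
    then obtain y where y: "stabilises (verts G) (f \<omega>) y" by blast
    have "process G (fst \<omega>) (snd \<omega>) t v = y"
      using G V y unfolding f_def by (rule process_eqI)
    with y stabilises_unique[OF y] show ?thesis by metis
  next
    case False
    have "process G (fst \<omega>) (snd \<omega>) t v = exhaustion_lim (verts G) (f \<omega>)"
      using \<open>infinite (verts G)\<close> by (simp add: process_def f_def[abs_def])
    also have "\<dots> = (THE y. False)"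
      using False V by (simp add: exhaustion_lim_eq_The)
    finally show ?thesis using False by auto
  qed
  show ?thesis unfolding eq
    by (intro sets.sets_Collect_disj sets.sets_Collect_conj sets.sets_Collect_countable_All
        sets.sets_Collect_neg sets.sets_Collect_const stab)
qed

lemma sets_all_process_eq:
  assumes "simple_graph G" "countable (verts G)" "finite W"
  shows "{\<omega> \<in> space (randomness G). \<forall>v\<in>W. process G (fst \<omega>) (snd \<omega>) t v = x} \<in> sets (randomness G)"
  using assms by (intro sets.sets_Collect_finite_All sets_process_eq)

end


section \<open>The split graph\<close>

lemma simple_graph_edgeE:
  assumes "simple_graph G" "e \<in> edges G"
  obtains a b where "e = {a, b}" "a \<noteq> b" "a \<in> verts G" "b \<in> verts G"
proof -
  obtain a b where "e = {a, b}" "a \<noteq> b"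
    using assms by (metis card_2_iff simple_graph_def)
  with assms show ?thesis using that by (auto simp: simple_graph_def)
qed

text \<open>
  The edge between \<open>a\<close> and \<open>b\<close> survives with each end that belongs to \<open>W\<close> replaced by its copy, also if
  both ends are split.
\<close>

lemma edges_split_graph:
  assumes G: "simple_graph G" and W: "finite W"
  defines "s \<equiv> \<lambda>W a b. if a \<in> W then Copy a b else Orig a"
  shows "edges (split_graph G W) = {{s W a b, s W b a} | a b. {a, b} \<in> edges G}"
  using W
proof (induction W)
  case empty
  have "(\<lambda>e. Orig ` e) ` edges G = {{Orig a, Orig b} | a b. {a, b} \<in> edges G}"
  proof (intro set_eqI iffI)
    fix e assume "e \<in> (\<lambda>e. Orig ` e) ` edges G"
    then obtain f where f: "f \<in> edges G" "e = Orig ` f" by blast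
    obtain a b where "f = {a, b}" using simple_graph_edgeE[OF G f(1)] by metis
    with f show "e \<in> {{Orig a, Orig b} | a b. {a, b} \<in> edges G}" by auto
  next
    fix e assume "e \<in> {{Orig a, Orig b} | a b. {a, b} \<in> edges G}"
    then obtain a b where "{a, b} \<in> edges G" "e = Orig ` {a, b}" by auto
    then show "e \<in> (\<lambda>e. Orig ` e) ` edges G" by blast
  qed
  then show ?case by (simp add: split_graph_empty s_def)
next
  case (insert w W)
  have ne: "a \<noteq> b" if "{a, b} \<in> edges G" for a b
    using G that by (auto simp: simple_graph_def)
  have nbr: "{Orig w, x} \<in> edges (split_graph G W) \<longleftrightarrow> (\<exists>n. {w, n} \<in> edges G \<and> x = s W n w)" for x
    using neighbours_split_graph[OF insert(1,2), of G]
    by (auto simp: neighbours_def s_def set_eq_iff image_iff)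
  have split: "edges (split_graph G (insert w W)) = edges (split_vertex w (split_graph G W))"
    using insert by (simp add: split_graph_insert)
  show ?case
  proof (intro set_eqI iffI)
    fix e assume "e \<in> edges (split_graph G (insert w W))"
    then consider "e \<in> edges (split_graph G W)" "Orig w \<notin> e"
      | n where "e = {Copy w (origin (s W n w)), s W n w}" "{w, n} \<in> edges G"
      unfolding split edges_split_vertex_iff nbr by (elim disjE exE conjE) metis+
    then show "e \<in> {{s (insert w W) a b, s (insert w W) b a} | a b. {a, b} \<in> edges G}"
    proof cases
      case 1
      then obtain a b where ab: "e = {s W a b, s W b a}" "{a, b} \<in> edges G" using insert.IH by blast
      with 1 insert(2) have "a \<noteq> w" "b \<noteq> w" by (auto simp: s_def)
      then have "e = {s (insert w W) a b, s (insert w W) b a}" using ab by (simp add: s_def)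
      with ab show ?thesis by blast
    next
      case (2 n)
      then have "e = {s (insert w W) w n, s (insert w W) n w}"
        using ne[of w n] by (auto simp: s_def)
      with 2 show ?thesis by blast
    qed
  next
    fix e assume "e \<in> {{s (insert w W) a b, s (insert w W) b a} | a b. {a, b} \<in> edges G}"
    then obtain a b where ab: "e = {s (insert w W) a b, s (insert w W) b a}" "{a, b} \<in> edges G"
      by blast
    have w: "{Copy w (origin (s W n w)), s W n w} \<in> edges (split_graph G (insert w W))"
      if "{w, n} \<in> edges G" for n
      unfolding split edges_split_vertex_iff nbr using that by blast
    consider "a = w" | "b = w" | "a \<noteq> w" "b \<noteq> w" by blast
    then show "e \<in> edges (split_graph G (insert w W))"
    proof cases
      case 1
      with ab ne have "e = {Copy w (origin (s W b w)), s W b w}" by (auto simp: s_def)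
      with w[of b] ab(2) 1 show ?thesis by (simp only:)
    next
      case 2
      with ab ne have "e = {Copy w (origin (s W a w)), s W a w}" by (auto simp: s_def)
      moreover have "{w, a} \<in> edges G" using ab(2) 2 by (simp add: insert_commute)
      ultimately show ?thesis using w[of a] by (simp only:)
    next
      case 3
      with ab have "e = {s W a b, s W b a}" by (auto simp: s_def)
      moreover from this 3 have "Orig w \<notin> e" by (auto simp: s_def)
      ultimately show ?thesis
        unfolding split edges_split_vertex_iff insert.IH using ab by blast
    qed
  qed
qed

lemma bij_betw_origin_edges:
  assumes "simple_graph G" "finite W"
  shows "bij_betw (image origin) (edges (split_graph G W)) (edges G)"
  unfolding bij_betw_def edges_split_graph[OF assms]
proof (intro conjI inj_onI)
  let ?s = "\<lambda>a b. if a \<in> W then Copy a b else Orig a"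
  let ?S = "{{?s a b, ?s b a} | a b. {a, b} \<in> edges G}"
  have origin_s: "origin ` {?s a b, ?s b a} = {a, b}" for a b by auto
  show "image origin ` ?S = edges G"
  proof (intro set_eqI iffI)
    fix e assume "e \<in> image origin ` ?S"
    then show "e \<in> edges G" using origin_s by force
  next
    fix e assume e: "e \<in> edges G"
    then obtain a b where "e = {a, b}" using simple_graph_edgeE[OF assms(1)] by metis
    with e show "e \<in> image origin ` ?S"
      by (intro image_eqI[OF _ CollectI, of _ _ "{?s a b, ?s b a}"]) (simp only: origin_s, blast)
  qed
  fix e f assume "e \<in> ?S" "f \<in> ?S" and eq: "origin ` e = origin ` f"
  then obtain a b a' b' where e: "e = {?s a b, ?s b a}" and f: "f = {?s a' b', ?s b' a'}" by blast
  with eq origin_s have "{a, b} = {a', b'}" by metis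
  then show "e = f" unfolding e f by (auto simp: doubleton_eq_iff)
qed

lemma simple_graph_split_graph:
  assumes "simple_graph G" "finite W"
  shows "simple_graph (split_graph G W)"
  unfolding simple_graph_def
proof
  fix e assume "e \<in> edges (split_graph G W)"
  then obtain a b where ab: "{a, b} \<in> edges G"
    and e: "e = {if a \<in> W then Copy a b else Orig a, if b \<in> W then Copy b a else Orig b}"
    unfolding edges_split_graph[OF assms] by blast
  from ab assms(1) have "a \<noteq> b" "a \<in> verts G" "b \<in> verts G"
    by (auto simp: simple_graph_def)
  with ab show "e \<subseteq> verts (split_graph G W) \<and> card e = 2"
    unfolding e verts_split_graph[OF assms(2)]
    by (auto simp: neighbours_def insert_commute)
qed

lemma neighbours_subset_verts: "simple_graph G \<Longrightarrow> neighbours G v \<subseteq> verts G"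
  by (auto simp: simple_graph_def neighbours_def)

lemma locally_bounded_if_bounded_degree:
  assumes G: "simple_graph G" and "bounded_degree G"
  shows "locally_bounded G"
proof -
  obtain D where D: "\<And>v. v \<in> verts G \<Longrightarrow> finite (neighbours G v) \<and> degree G v \<le> D"
    using assms(2) unfolding bounded_degree_def by blast
  have "finite {e \<in> edges G. v \<in> e} \<and> card {e \<in> edges G. v \<in> e} \<le> D" for v
  proof (cases "v \<in> verts G")
    case True
    have "{e \<in> edges G. v \<in> e} \<subseteq> (\<lambda>u. {v, u}) ` neighbours G v"
    proof
      fix e assume e: "e \<in> {e \<in> edges G. v \<in> e}"
      then obtain a b where "e = {a, b}" using simple_graph_edgeE[OF G] by blast
      then show "e \<in> (\<lambda>u. {v, u}) ` neighbours G v"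
        using e by (auto simp: neighbours_def insert_commute)
    qed
    moreover have "finite (neighbours G v)" "card (neighbours G v) \<le> D"
      using D[OF True] by (auto simp: degree_def)
    ultimately show ?thesis
      by (meson card_image_le card_mono finite_imageI finite_subset order_trans)
  next
    case False
    then have "{e \<in> edges G. v \<in> e} = {}" using G by (auto simp: simple_graph_def)
    then show ?thesis by (simp only: finite.emptyI card.empty le0 simp_thms)
  qed
  then show ?thesis unfolding locally_bounded_def by blast
qed

lemma bounded_degree_if_finite:
  assumes "simple_graph G" "finite (verts G)"
  shows "bounded_degree G"
  unfolding bounded_degree_def degree_def
  using neighbours_subset_verts[OF assms(1)] assms(2)
  by (intro exI[of _ "card (verts G)"]) (auto intro: finite_subset card_mono)

lemma finite_neighbours:
  assumes "locally_bounded G"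
  shows "finite (neighbours G v)"
proof (rule inj_on_finite)
  show "inj_on (\<lambda>u. {v, u}) (neighbours G v)" by (auto simp: inj_on_def doubleton_eq_iff)
  show "(\<lambda>u. {v, u}) ` neighbours G v \<subseteq> {e \<in> edges G. v \<in> e}" by (auto simp: neighbours_def)
  show "finite {e \<in> edges G. v \<in> e}" using assms by (auto simp: locally_bounded_def)
qed

lemma finite_copies:
  assumes "finite W" "locally_bounded G"
  shows "finite (copies G W)"
proof -
  have "copies G W = (\<Union>w\<in>W. Copy w ` neighbours G w)"
    by (auto simp: copies_eq[OF assms(1)])
  then show ?thesis using assms finite_neighbours[OF assms(2)] by simp
qed

lemma locally_bounded_split_graph:
  assumes "simple_graph G" "finite W" "locally_bounded G"
  shows "locally_bounded (split_graph G W)"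
proof -
  let ?G' = "split_graph G W"
  obtain D where D: "\<And>v. finite {e \<in> edges G. v \<in> e} \<and> card {e \<in> edges G. v \<in> e} \<le> D"
    using assms(3) unfolding locally_bounded_def by blast
  have "finite {e \<in> edges ?G'. y \<in> e} \<and> card {e \<in> edges ?G'. y \<in> e} \<le> D" for y
  proof -
    have b: "bij_betw (image origin) (edges ?G') (edges G)"
      using assms(1,2) by (rule bij_betw_origin_edges)
    have "inj_on (image origin) {e \<in> edges ?G'. y \<in> e}"
      using bij_betw_imp_inj_on[OF b] by (rule inj_on_subset) auto
    moreover have "image origin ` {e \<in> edges ?G'. y \<in> e} \<subseteq> {e \<in> edges G. origin y \<in> e}"
      using bij_betw_imp_surj_on[OF b] by auto
    ultimately show ?thesis
      using D[of "origin y"] by (meson card_inj_on_le inj_on_finite order_trans)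
  qed
  then show ?thesis unfolding locally_bounded_def by blast
qed

lemma countable_verts_split_graph:
  assumes "simple_graph G" "finite W" "countable (verts G)"
  shows "countable (verts (split_graph G W))"
proof (rule countable_subset)
  show "verts (split_graph G W) \<subseteq> Orig ` verts G \<union> (\<lambda>(w, n). Copy w n) ` (W \<times> verts G)"
    using neighbours_subset_verts[OF assms(1)] by (force simp: verts_split_graph[OF assms(2)])
  show "countable (Orig ` verts G \<union> (\<lambda>(w, n). Copy w n) ` (W \<times> verts G))"
    using assms by (intro countable_Un countable_image countable_SIGMA) (auto intro: countable_finite)
qed

lemma copies_eq_origin:
  assumes "finite W"
  shows "copies G W = {y \<in> verts (split_graph G W). origin y \<in> W}"
  unfolding copies_eq[OF assms] verts_split_graph[OF assms] by auto


section \<open>Equality of the two events under a coupling\<close>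

context flip_rule
begin

text \<open>
  Here \<open>\<pi>\<close> identifies vertices of \<open>S\<close>, but only such as are mapped into \<open>W\<close>; for the split graph it is
  \<open>origin\<close>. The invariant behind the equivalence adds that, as long as it holds, the process on \<open>S\<close> is the
  process on the image composed with \<open>\<pi>\<close>. A ring that changes a vertex of \<open>W\<close> makes both sides false for good. Any
  other effective ring changes a vertex outside \<open>W\<close>, which has a single preimage, so that the two
  processes keep agreeing.
\<close>

lemma fold_step_quotient:
  fixes \<pi> :: "'a \<Rightarrow> 'b" and S :: "'a set" and W :: "'b set"
  assumes "\<And>y y'. y \<in> S \<Longrightarrow> y' \<in> S \<Longrightarrow> \<pi> y = \<pi> y' \<Longrightarrow> \<pi> y \<notin> W \<Longrightarrow> y = y'"
    and "\<And>e. e \<in> set es \<Longrightarrow> e \<subseteq> S \<and> d' e \<in> e \<and> d (\<pi> ` e) = \<pi> (d' e)"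
  defines "x \<equiv> fold (step d) (map (image \<pi>) es) (\<lambda>_. c)" and "x' \<equiv> fold (step d') es (\<lambda>_. c)"
  shows "(\<forall>w\<in>W. x w = c) \<longleftrightarrow> (\<forall>y\<in>S. \<pi> y \<in> W \<longrightarrow> x' y = c)"
proof -
  have "((\<forall>w\<in>W. x w = c) \<longleftrightarrow> (\<forall>y\<in>S. \<pi> y \<in> W \<longrightarrow> x' y = c)) \<and>
    ((\<forall>w\<in>W. x w = c) \<longrightarrow> (\<forall>y\<in>S. x' y = x (\<pi> y)))"
    using assms(2) unfolding x_def x'_def
  proof (induction es rule: rev_induct)
    case (snoc e es)
    define x where "x = fold (step d) (map (image \<pi>) es) (\<lambda>_. c)"
    define x' where "x' = fold (step d') es (\<lambda>_. c)"
    have IH: "(\<forall>w\<in>W. x w = c) \<longleftrightarrow> (\<forall>y\<in>S. \<pi> y \<in> W \<longrightarrow> x' y = c)"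
      "(\<forall>w\<in>W. x w = c) \<Longrightarrow> y \<in> S \<Longrightarrow> x' y = x (\<pi> y)" for y
      using snoc.IH snoc.prems unfolding x_def x'_def by simp_all
    have e: "e \<subseteq> S" "d' e \<in> e" "d (\<pi> ` e) = \<pi> (d' e)"
      using snoc.prems by auto
    define x1 where "x1 = step d (\<pi> ` e) x"
    define x1' where "x1' = step d' e x'"
    have "((\<forall>w\<in>W. x1 w = c) \<longleftrightarrow> (\<forall>y\<in>S. \<pi> y \<in> W \<longrightarrow> x1' y = c)) \<and>
      ((\<forall>w\<in>W. x1 w = c) \<longrightarrow> (\<forall>y\<in>S. x1' y = x1 (\<pi> y)))"
    proof (cases "\<forall>w\<in>W. x w = c")
      case False
      then obtain w y where w: "w \<in> W" "x w \<noteq> c" and y: "y \<in> S" "\<pi> y \<in> W" "x' y \<noteq> c"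
        using IH(1) by auto
      have "x1 w \<noteq> c" "x1' y \<noteq> c"
        unfolding x1_def x1'_def by (rule step_keeps_flipped; fact)+
      with w y show ?thesis by blast
    next
      case True
      have eq: "x' y = x (\<pi> y)" if "y \<in> S" for y using IH(2)[OF True that] .
      then have eqe: "x (\<pi> u) = x' u" if "u \<in> e" for u using that e(1) by auto
      have fires: "(\<forall>u\<in>\<pi> ` e. x u = c) \<longleftrightarrow> (\<forall>u\<in>e. x' u = c)" by (simp add: eqe)
      show ?thesis
      proof (cases "\<forall>u\<in>e. x' u = c")
        case False
        then have "x1 = x" "x1' = x'"
          unfolding x1_def x1'_def step_def using fires by (simp_all only: if_False)
        then show ?thesis using True IH(1) eq by simp
      next
        case fire: True
        \<comment> \<open>The vertices that the ring changes on the side of \<open>S\<close>; on the other side it changes \<open>\<pi> ` H\<close>.\<close>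
        define H where "H = (if both then e else {d' e})"
        have H: "H \<subseteq> S" using e by (auto simp: H_def)
        have x1: "x1 v = (if v \<in> \<pi> ` H then c' else x v)" for v
          using fire fires e(3) by (auto simp: x1_def step_def H_def)
        have x1': "x1' y = (if y \<in> H then c' else x' y)" for y
          using fire by (simp add: x1'_def step_def H_def)
        show ?thesis
        proof (cases "\<pi> ` H \<inter> W = {}")
          case False
          then obtain y where y: "y \<in> H" "\<pi> y \<in> W" by blast
          then have "x1 (\<pi> y) \<noteq> c" "x1' y \<noteq> c" using flip by (auto simp: x1 x1')
          with y H show ?thesis by blast
        next
          case disj: True
          have "x1' y = x1 (\<pi> y)" if "y \<in> S" for y
          proof -
            have "y \<in> H" if "\<pi> y \<in> \<pi> ` H"
              using that disj H assms(1)[OF \<open>y \<in> S\<close>] by blast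
            then show ?thesis using eq[OF that] by (auto simp: x1 x1')
          qed
          moreover have "\<forall>w\<in>W. x1 w = c" using True disj by (auto simp: x1)
          ultimately show ?thesis by auto
        qed
      qed
    qed
    have folds: "fold (step d) (map (image \<pi>) (es @ [e])) (\<lambda>_. c) = x1"
      "fold (step d') (es @ [e]) (\<lambda>_. c) = x1'"
      by (simp_all add: x_def x'_def x1_def x1'_def)
    show ?case unfolding folds by fact
  qed simp
  then show ?thesis by blast
qed

text \<open>
  On the finite vertex set \<open>U\<close> of \<open>G\<close> and its full preimage \<open>U'\<close> in the split graph, corresponding edges ring in
  the same order.
\<close>

lemma run_split_graph:
  assumes G: "simple_graph G" and W: "finite W" and U: "finite U"
    and inj: "inj_on \<tau>' (edges (split_graph G W))"
    and d': "\<And>e. e \<in> edges (split_graph G W) \<Longrightarrow> d' e \<in> e"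
    and \<tau>: "\<And>e. e \<in> edges (split_graph G W) \<Longrightarrow> \<tau> (origin ` e) = \<tau>' e"
    and d: "\<And>e. e \<in> edges (split_graph G W) \<Longrightarrow> d (origin ` e) = origin (d' e)"
  defines "U' \<equiv> {y \<in> verts (split_graph G W). origin y \<in> U}"
  shows "(\<forall>w\<in>W. run (induced_subgraph G U) \<tau> d t w = c) \<longleftrightarrow>
    (\<forall>y\<in>copies G W. run (induced_subgraph (split_graph G W) U') \<tau>' d' t y = c)"
proof -
  let ?G' = "split_graph G W"
  let ?H = "induced_subgraph G U" and ?H' = "induced_subgraph ?G' U'"
  let ?es = "rings_until ?H' \<tau>' t"
  have b: "bij_betw (image origin) (edges ?G') (edges G)"
    using G W by (rule bij_betw_origin_edges)
  have sub: "e \<subseteq> verts ?G'" if "e \<in> edges ?G'" for e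
    using simple_graph_split_graph[OF G W] that by (simp add: simple_graph_def)
  have H': "edges ?H' = {e \<in> edges ?G'. origin ` e \<subseteq> U}"
    using sub by (auto simp: induced_subgraph_def U'_def)
  have H: "edges ?H = image origin ` edges ?H'"
  proof -
    have "edges ?H = {e \<in> edges G. e \<subseteq> U}" by (simp add: induced_subgraph_def)
    also have "\<dots> = image origin ` edges ?H'"
      unfolding H' bij_betw_imp_surj_on[OF b, symmetric] by auto
    finally show ?thesis .
  qed
  have injH: "inj_on (image origin) (edges ?H')"
    using bij_betw_imp_inj_on[OF b] by (rule inj_on_subset) (auto simp: H')
  have finH: "finite (edges ?H)" using U by (rule finite_edges_induced_subgraph)
  then have finH': "finite (edges ?H')" unfolding H using injH by (rule finite_imageD)
  note es = rings_until_props[OF finH', of \<tau>' t]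
  have es_edges: "e \<in> edges ?G'" if "e \<in> set ?es" for e
    using that es H' by auto
  have "rings_until ?H \<tau> t = map (image origin) ?es"
  proof (rule rings_until_eqI[OF finH])
    show "inj_on \<tau> (edges ?H)"
      unfolding H using inj \<tau> by (auto simp: H' inj_on_def)
    show "set (map (image origin) ?es) = {e \<in> edges ?H. \<tau> e \<le> t}"
      unfolding H using es \<tau> by (auto simp: H')
    show "distinct (map (image origin) ?es)"
      using es injH by (auto simp: distinct_map intro: inj_on_subset)
    have "map \<tau> (map (image origin) ?es) = map \<tau>' ?es"
      using \<tau> es_edges by simp
    with es(3) show "sorted (map \<tau> (map (image origin) ?es))" by (simp only:)
  qed
  moreover have "(\<forall>w\<in>W. fold (step d) (map (image origin) ?es) (\<lambda>_. c) w = c) \<longleftrightarrow>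
    (\<forall>y\<in>verts ?G'. origin y \<in> W \<longrightarrow> fold (step d') ?es (\<lambda>_. c) y = c)"
  proof (rule fold_step_quotient)
    fix y y' assume "y \<in> verts ?G'" "y' \<in> verts ?G'" "origin y = origin y'" "origin y \<notin> W"
    then show "y = y'" by (auto simp: verts_split_graph[OF W])
  next
    fix e assume "e \<in> set ?es"
    from es_edges[OF this] show "e \<subseteq> verts ?G' \<and> d' e \<in> e \<and> d (origin ` e) = origin (d' e)"
      using sub d' d by blast
  qed
  ultimately show ?thesis
    unfolding run_def copies_eq_origin[OF W] by (simp only: mem_Collect_eq Ball_def imp_conjL)
qed

lemma process_eq_run:
  assumes G: "simple_graph G" "countable (verts G)" and W: "finite W"
    and stab: "\<And>v. v \<in> W \<Longrightarrow>
      \<exists>x. stabilises (verts G) (\<lambda>U. run (induced_subgraph G U) \<tau> d t v) x"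
  obtains A where "A \<in> Fpow (verts G)"
    and "\<And>U v. U \<in> Fpow (verts G) \<Longrightarrow> A \<subseteq> U \<Longrightarrow> v \<in> W \<Longrightarrow>
      run (induced_subgraph G U) \<tau> d t v = process G \<tau> d t v"
proof -
  have "\<exists>A\<in>Fpow (verts G). \<forall>U\<in>Fpow (verts G). A \<subseteq> U \<longrightarrow>
    run (induced_subgraph G U) \<tau> d t v = process G \<tau> d t v" if "v \<in> W" for v
  proof -
    obtain x where x: "stabilises (verts G) (\<lambda>U. run (induced_subgraph G U) \<tau> d t v) x"
      using stab[OF \<open>v \<in> W\<close>] by blast
    then have "process G \<tau> d t v = x" by (rule process_eqI[OF G])
    with x show ?thesis by (simp add: stabilises_def)
  qed
  then obtain A where A: "\<And>v. v \<in> W \<Longrightarrow> A v \<in> Fpow (verts G)"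
    "\<And>v U. v \<in> W \<Longrightarrow> U \<in> Fpow (verts G) \<Longrightarrow> A v \<subseteq> U \<Longrightarrow>
      run (induced_subgraph G U) \<tau> d t v = process G \<tau> d t v"
    by metis
  show ?thesis
  proof (rule that[of "\<Union>v\<in>W. A v"])
    show "(\<Union>v\<in>W. A v) \<in> Fpow (verts G)" using A(1) W by (auto simp: Fpow_def)
  qed (use A(2) in blast)
qed

text \<open>
  A finite vertex set that is large enough for the limits at \<open>W\<close>, and whose preimage is large enough for the
  limits at the finitely many copies, reduces the claim to runs on finite graphs.
\<close>

lemma process_split_graph:
  assumes G: "simple_graph G" "countable (verts G)" "locally_bounded G"
    and W: "finite W" "W \<subseteq> verts G"
    and inj: "inj_on \<tau>' (edges (split_graph G W))"
    and d': "\<And>e. e \<in> edges (split_graph G W) \<Longrightarrow> d' e \<in> e"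
    and \<tau>: "\<And>e. e \<in> edges (split_graph G W) \<Longrightarrow> \<tau> (origin ` e) = \<tau>' e"
    and d: "\<And>e. e \<in> edges (split_graph G W) \<Longrightarrow> d (origin ` e) = origin (d' e)"
    and stab: "\<And>v. v \<in> W \<Longrightarrow>
      \<exists>x. stabilises (verts G) (\<lambda>U. run (induced_subgraph G U) \<tau> d t v) x"
    and stab': "\<And>y. y \<in> copies G W \<Longrightarrow>
      \<exists>x. stabilises (verts (split_graph G W))
        (\<lambda>U. run (induced_subgraph (split_graph G W) U) \<tau>' d' t y) x"
  shows "(\<forall>w\<in>W. process G \<tau> d t w = c) \<longleftrightarrow>
    (\<forall>y\<in>copies G W. process (split_graph G W) \<tau>' d' t y = c)"
proof -
  let ?G' = "split_graph G W"
  have G': "simple_graph ?G'" "countable (verts ?G')"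
    using G W by (simp_all add: simple_graph_split_graph countable_verts_split_graph)
  have origin: "origin y \<in> verts G" if "y \<in> verts ?G'" for y
    using that W by (auto simp: verts_split_graph)
  have fin_copies: "finite (copies G W)" using W(1) G(3) by (rule finite_copies)
  obtain A where A: "A \<in> Fpow (verts G)"
    and A_run: "\<And>U v. U \<in> Fpow (verts G) \<Longrightarrow> A \<subseteq> U \<Longrightarrow> v \<in> W \<Longrightarrow>
      run (induced_subgraph G U) \<tau> d t v = process G \<tau> d t v"
    using process_eq_run[OF G(1,2) W(1) stab] by blast
  obtain B where B: "B \<in> Fpow (verts ?G')"
    and B_run: "\<And>U y. U \<in> Fpow (verts ?G') \<Longrightarrow> B \<subseteq> U \<Longrightarrow> y \<in> copies G W \<Longrightarrow>
      run (induced_subgraph ?G' U) \<tau>' d' t y = process ?G' \<tau>' d' t y"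
    using process_eq_run[OF G' fin_copies stab'] by blast
  define U where "U = A \<union> origin ` B"
  define U' where "U' = {y \<in> verts ?G'. origin y \<in> U}"
  have U: "U \<in> Fpow (verts G)" "A \<subseteq> U"
    using A B origin by (auto simp: U_def Fpow_def)
  have "U' \<subseteq> Orig ` U \<union> copies G W"
    by (auto simp: U'_def verts_split_graph[OF W(1)] copies_eq[OF W(1)])
  then have "finite U'"
    using fin_copies U by (auto simp: Fpow_def intro: finite_subset)
  then have U': "U' \<in> Fpow (verts ?G')" "B \<subseteq> U'"
    using B by (auto simp: U'_def U_def Fpow_def)
  have "(\<forall>w\<in>W. run (induced_subgraph G U) \<tau> d t w = c) \<longleftrightarrow>
    (\<forall>y\<in>copies G W. run (induced_subgraph ?G' U') \<tau>' d' t y = c)"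
    unfolding U'_def using U by (intro run_split_graph G W inj d' \<tau> d) (auto simp: Fpow_def)
  then show ?thesis using A_run[OF U] B_run[OF U'] by simp
qed

end


section \<open>The coupling preserves the measure\<close>

definition split_edge :: "'v graph \<Rightarrow> 'v set \<Rightarrow> 'v set \<Rightarrow> 'v split_vert set" where
  "split_edge G W = the_inv_into (edges (split_graph G W)) (image origin)"

text \<open>
  The coupling: it reads the ringing times and attacks for \<open>G\<close> off those for the split graph.
\<close>

definition unsplit ::
  "'v graph \<Rightarrow> 'v set \<Rightarrow>
    ('v split_vert set \<Rightarrow> real) \<times> ('v split_vert set \<Rightarrow> 'v split_vert) \<Rightarrow>
    ('v set \<Rightarrow> real) \<times> ('v set \<Rightarrow> 'v)" where
  "unsplit G W = (\<lambda>(\<tau>, d).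
    (\<lambda>e\<in>edges G. \<tau> (split_edge G W e), \<lambda>e\<in>edges G. origin (d (split_edge G W e))))"

lemma split_edge:
  assumes "simple_graph G" "finite W"
  shows "e' \<in> edges (split_graph G W) \<Longrightarrow> split_edge G W (origin ` e') = e'"
    and "e \<in> edges G \<Longrightarrow> split_edge G W e \<in> edges (split_graph G W)"
    and "e \<in> edges G \<Longrightarrow> origin ` split_edge G W e = e"
    and "inj_on (split_edge G W) (edges G)"
proof -
  note b = bij_betw_origin_edges[OF assms]
  note inj = bij_betw_imp_inj_on[OF b] and surj = bij_betw_imp_surj_on[OF b]
  show "e' \<in> edges (split_graph G W) \<Longrightarrow> split_edge G W (origin ` e') = e'"
    using the_inv_into_f_f[OF inj] by (simp add: split_edge_def)
  show "e \<in> edges G \<Longrightarrow> split_edge G W e \<in> edges (split_graph G W)"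
    using the_inv_into_into[OF inj, of e] surj by (auto simp: split_edge_def)
  show "e \<in> edges G \<Longrightarrow> origin ` split_edge G W e = e"
    using f_the_inv_into_f[OF inj, of e] surj by (simp add: split_edge_def)
  show "inj_on (split_edge G W) (edges G)"
    using inj_on_the_inv_into[OF inj] surj by (simp add: split_edge_def)
qed

text \<open>
  An edge and its counterpart both have two ends, so \<open>origin\<close> is injective on the latter and carries
  the uniform choice of an attacked end to the uniform choice.
\<close>

lemma distr_unsplit:
  assumes G: "simple_graph G" and W: "finite W"
  shows "unsplit G W \<in> measurable (randomness (split_graph G W)) (randomness G)"
    and "distr (randomness (split_graph G W)) (randomness G) (unsplit G W) = randomness G"
proof -
  let ?G' = "split_graph G W" and ?s = "split_edge G W"
  let ?T = "\<lambda>\<tau>. \<lambda>e\<in>edges G. \<tau> (?s e)" and ?D = "\<lambda>d. \<lambda>e\<in>edges G. origin (d (?s e))"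
  note s = split_edge[OF G W]
  have s_fun: "?s \<in> edges G \<rightarrow> edges ?G'" using s(2) by blast
  have T: "?T \<in> measurable (ring_times ?G') (ring_times G)"
    "distr (ring_times ?G') (ring_times G) ?T = ring_times G"
    unfolding ring_times_def
    by (rule distr_PiM_transport[where g = "\<lambda>_ x. x", OF prob_space_ring_time prob_space_ring_time s(4) s_fun];
        simp add: distr_id2)+
  have origin_unif: "distr (measure_pmf (pmf_of_set (?s e))) (measure_pmf (pmf_of_set e)) origin =
      measure_pmf (pmf_of_set e)" if e: "e \<in> edges G" for e
  proof -
    have "card e = 2" using G e by (simp add: simple_graph_def)
    moreover have "card (?s e) = 2"
      using simple_graph_split_graph[OF G W] s(2)[OF e] by (simp add: simple_graph_def)
    ultimately have se: "finite (?s e)" "?s e \<noteq> {}" "card (origin ` ?s e) = card (?s e)"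
      using s(3)[OF e] by (auto intro: card_ge_0_finite)
    then have "inj_on origin (?s e)" by (intro eq_card_imp_inj_on)
    with se have "map_pmf origin (pmf_of_set (?s e)) = pmf_of_set e"
      by (simp add: map_pmf_of_set_inj s(3)[OF e])
    then have "measure_pmf (pmf_of_set e) = distr (measure_pmf (pmf_of_set (?s e))) (count_space UNIV) origin"
      by (metis map_pmf_rep_eq)
    moreover have "distr (measure_pmf (pmf_of_set (?s e))) (measure_pmf (pmf_of_set e)) origin =
      distr (measure_pmf (pmf_of_set (?s e))) (count_space UNIV) origin"
      by (rule distr_cong) simp_all
    ultimately show ?thesis by simp
  qed
  have D: "?D \<in> measurable (attacks ?G') (attacks G)"
    "distr (attacks ?G') (attacks G) ?D = attacks G"
    unfolding attacks_def
    by (rule distr_PiM_transport[where g = "\<lambda>_. origin", OF prob_space_measure_pmf prob_space_measure_pmf s(4) s_fun];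
        simp add: origin_unif)+
  show "unsplit G W \<in> measurable (randomness ?G') (randomness G)"
    unfolding unsplit_def randomness_def case_prod_beta
    using T(1) D(1)
    by (intro measurable_Pair measurable_compose[OF measurable_fst] measurable_compose[OF measurable_snd])
  have "sigma_finite_measure (distr (attacks ?G') (attacks G) ?D)"
    unfolding D(2) using prob_space_attacks by (rule prob_space_imp_sigma_finite)
  from pair_measure_distr[OF T(1) D(1) this]
  show "distr (randomness ?G') (randomness G) (unsplit G W) = randomness G"
    by (simp add: T(2) D(2) randomness_def unsplit_def)
qed


section \<open>Equality of the probabilities\<close>

lemma (in flip_rule) prob_process_split_graph:
  assumes G: "simple_graph G" "countable (verts G)" "locally_bounded G"
    and W: "finite W" "W \<subseteq> verts G"
  shows "\<P>(\<omega> in randomness G. \<forall>v\<in>W. process G (fst \<omega>) (snd \<omega>) t v = c) =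
    \<P>(\<omega> in randomness (split_graph G W).
      \<forall>y\<in>copies G W. process (split_graph G W) (fst \<omega>) (snd \<omega>) t y = c)"
proof -
  let ?G' = "split_graph G W" and ?T = "unsplit G W"
  let ?M = "randomness G" and ?M' = "randomness ?G'"
  let ?A = "{\<omega> \<in> space ?M. \<forall>v\<in>W. process G (fst \<omega>) (snd \<omega>) t v = c}"
  let ?A' = "{\<omega> \<in> space ?M'. \<forall>y\<in>copies G W. process ?G' (fst \<omega>) (snd \<omega>) t y = c}"
  have G': "simple_graph ?G'" "countable (verts ?G')" "locally_bounded ?G'"
    using G W by (simp_all add: simple_graph_split_graph countable_verts_split_graph locally_bounded_split_graph)
  have copies: "finite (copies G W)" "copies G W \<subseteq> verts ?G'"
    using finite_copies[OF W(1) G(3)] by (simp_all add: copies_eq_origin[OF W(1)])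
  note T = distr_unsplit[OF G(1) W(1)]
  have A: "?A \<in> sets ?M" using G W by (intro sets_all_process_eq)
  have A': "?A' \<in> sets ?M'" using G' copies by (intro sets_all_process_eq)
  have "AE \<omega> in ?M. \<forall>v\<in>W. \<exists>x. stabilises (verts G)
      (\<lambda>U. run (induced_subgraph G U) (fst \<omega>) (snd \<omega>) t v) x"
    using W by (intro AE_finite_allI AE_run_stabilises G) auto
  then have "AE \<omega> in distr ?M' ?M ?T. \<forall>v\<in>W. \<exists>x. stabilises (verts G)
      (\<lambda>U. run (induced_subgraph G U) (fst \<omega>) (snd \<omega>) t v) x"
    by (simp only: T(2))
  then have stab: "AE \<omega> in ?M'. \<forall>v\<in>W. \<exists>x. stabilises (verts G)
      (\<lambda>U. run (induced_subgraph G U) (fst (?T \<omega>)) (snd (?T \<omega>)) t v) x"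
    by (rule AE_distrD[OF T(1)])
  have stab': "AE \<omega> in ?M'. \<forall>y\<in>copies G W. \<exists>x. stabilises (verts ?G')
      (\<lambda>U. run (induced_subgraph ?G' U) (fst \<omega>) (snd \<omega>) t y) x"
    using copies by (intro AE_finite_allI AE_run_stabilises G') auto
  have inj: "AE \<omega> in ?M'. inj_on (fst \<omega>) (edges ?G')"
    unfolding randomness_def using prob_space_attacks AE_inj_ring_times[OF G'(1,2)] by (rule AE_pair_fst)
  have mem: "AE \<omega> in ?M'. \<forall>e\<in>edges ?G'. snd \<omega> e \<in> e"
    unfolding randomness_def
    using prob_space_ring_times prob_space_attacks AE_attacks_mem[OF G'(1,2)] by (rule AE_pair_snd)
  have "AE \<omega> in ?M'. \<omega> \<in> ?T -` ?A \<inter> space ?M' \<longleftrightarrow> \<omega> \<in> ?A'"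
    using stab stab' inj mem AE_space
  proof eventually_elim
    case (elim \<omega>)
    have unsplit: "fst (?T \<omega>) (origin ` e) = fst \<omega> e" "snd (?T \<omega>) (origin ` e) = origin (snd \<omega> e)"
      if "e \<in> edges ?G'" for e
      using that split_edge(1)[OF G(1) W(1) that] bij_betw_imp_surj_on[OF bij_betw_origin_edges[OF G(1) W(1)]]
      by (auto simp: unsplit_def case_prod_beta)
    have "(\<forall>v\<in>W. process G (fst (?T \<omega>)) (snd (?T \<omega>)) t v = c) \<longleftrightarrow>
      (\<forall>y\<in>copies G W. process ?G' (fst \<omega>) (snd \<omega>) t y = c)"
      using elim unsplit by (intro process_split_graph G W) auto
    with elim(5) measurable_space[OF T(1)] show ?case by auto
  qed
  then have "measure ?M' (?T -` ?A \<inter> space ?M') = measure ?M' ?A'"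
    using measurable_sets[OF T(1) A] A' by (rule measure_eq_AE)
  moreover have "measure ?M ?A = measure ?M' (?T -` ?A \<inter> space ?M')"
    using measure_distr[OF T(1), of ?A] A by (simp only: T(2))
  ultimately show ?thesis by simp
qed

lemma dimer_step_eq: "dimer_step = flip_rule.step True 0 1 d"
proof -
  interpret flip_rule True 0 1 by unfold_locales simp
  show ?thesis by (simp add: fun_eq_iff dimer_step_def step_def del: One_nat_def)
qed

lemma dimer_eq_process: "dimer G \<tau> t v = flip_rule.process True 0 1 G \<tau> d t v"
proof -
  interpret flip_rule True 0 1 by unfold_locales simp
  show ?thesis
    by (simp add: dimer_def process_def dimer_finite_def run_def dimer_step_eq[of d] del: One_nat_def)
qed

lemma annihilation_step_eq: "annihilation_step d = flip_rule.step False 1 0 d"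
proof -
  interpret flip_rule False 1 0 by unfold_locales simp
  show ?thesis by (simp add: fun_eq_iff annihilation_step_def step_def del: One_nat_def)
qed

lemma annihilation_eq_process: "annihilation G \<tau> d t v = flip_rule.process False 1 0 G \<tau> d t v"
proof -
  interpret flip_rule False 1 0 by unfold_locales simp
  show ?thesis
    by (simp add: annihilation_def process_def annihilation_finite_def run_def annihilation_step_eq
        del: One_nat_def)
qed

lemma prob_annihilation_eq_process:
  "\<P>((\<tau>, d) in ring_times G \<Otimes>\<^sub>M attacks G. \<forall>v\<in>W. annihilation G \<tau> d t v = 1) =
    \<P>(\<omega> in randomness G. \<forall>v\<in>W. flip_rule.process False 1 0 G (fst \<omega>) (snd \<omega>) t v = 1)"
  unfolding randomness_def annihilation_eq_process
  by (rule arg_cong[where f = "measure _"]) auto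

text \<open>
  Dimer RSA ignores the attacks, so its law can be computed on the larger space that includes them.
\<close>

lemma prob_dimer_eq_process:
  assumes "simple_graph G" "countable (verts G)" "finite W"
  shows "\<P>(\<tau> in ring_times G. \<forall>v\<in>W. dimer G \<tau> t v = 0) =
    \<P>(\<omega> in randomness G. \<forall>v\<in>W. flip_rule.process True 0 1 G (fst \<omega>) (snd \<omega>) t v = 0)"
proof -
  interpret flip_rule True 0 1 by unfold_locales simp
  interpret N: prob_space "attacks G" by (rule prob_space_attacks)
  let ?A = "{\<tau> \<in> space (ring_times G). \<forall>v\<in>W. dimer G \<tau> t v = 0}"
  let ?B = "{\<omega> \<in> space (randomness G). \<forall>v\<in>W. process G (fst \<omega>) (snd \<omega>) t v = 0}"
  \<comment> \<open>The event for \<open>\<tau>\<close> alone is the section of a measurable event at an arbitrary \<open>d\<close>.\<close>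
  obtain d where d: "d \<in> space (attacks G)" using N.not_empty by blast
  have B: "?B \<in> sets (randomness G)" using assms by (intro sets_all_process_eq)
  have "(\<lambda>\<tau>. (\<tau>, d)) -` ?B \<inter> space (ring_times G) = ?A"
    using d by (auto simp: randomness_def space_pair_measure dimer_eq_process[of G _ t _ d] simp del: One_nat_def)
  with measurable_sets[OF measurable_Pair2'[OF d] B[unfolded randomness_def]]
  have A: "?A \<in> sets (ring_times G)" by (simp add: randomness_def)
  have "measure (ring_times G) ?A = measure (distr (randomness G) (ring_times G) fst) ?A"
    by (simp add: randomness_def N.distr_pair_fst)
  also have "\<dots> = measure (randomness G) (fst -` ?A \<inter> space (randomness G))"
    using A by (intro measure_distr) (simp_all add: randomness_def)
  also have "fst -` ?A \<inter> space (randomness G) = ?B"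
    by (auto simp: randomness_def space_pair_measure simp flip: dimer_eq_process simp del: One_nat_def)
  finally show ?thesis .
qed

theorem proposition4:
  fixes G :: "'v graph" and W :: "'v set" and t :: real
  assumes "simple_graph G"
    and "finite (verts G) \<or> (infinite (verts G) \<and> countable (verts G) \<and> bounded_degree G)"
    and "finite W" and "W \<subseteq> verts G"
    and "0 \<le> t" and "t \<le> 1"
  shows "\<P>(\<tau> in ring_times G. \<forall>v\<in>W. dimer G \<tau> t v = 0) =
         \<P>(\<tau> in ring_times (split_graph G W).
            \<forall>v\<in>copies G W. dimer (split_graph G W) \<tau> t v = 0) \<and>
         \<P>((\<tau>, d) in ring_times G \<Otimes>\<^sub>M attacks G. \<forall>v\<in>W. annihilation G \<tau> d t v = 1) =
         \<P>((\<tau>, d) in ring_times (split_graph G W) \<Otimes>\<^sub>M attacks (split_graph G W).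
            \<forall>v\<in>copies G W. annihilation (split_graph G W) \<tau> d t v = 1)"
proof -
  have cb: "countable (verts G)" "locally_bounded G"
    using assms(1,2) bounded_degree_if_finite[OF assms(1)]
    by (auto intro: countable_finite locally_bounded_if_bounded_degree)
  interpret dimer: flip_rule True 0 1 by unfold_locales simp
  interpret annihilation: flip_rule False 1 0 by unfold_locales simp
  have copies: "finite (copies G W)" using assms(3) cb(2) by (rule finite_copies)
  have G': "simple_graph (split_graph G W)" "countable (verts (split_graph G W))"
    using assms cb by (simp_all add: simple_graph_split_graph countable_verts_split_graph)
  show ?thesis
    using dimer.prob_process_split_graph[OF assms(1) cb assms(3,4), of t]
      annihilation.prob_process_split_graph[OF assms(1) cb assms(3,4), of t]
    by (simp add: prob_dimer_eq_process prob_annihilation_eq_process assms cb G' copies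
        del: One_nat_def)
qed

end
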